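(* There is a polynomial-time algorithm that, given $C,C'\in\mathcal{L}(\geq,\sqcap,\top)$, decides whether $\models C\sqsubseteq C'$.
   Context: $\mathcal{L}(\geq,\sqcap,\top)$ is the set of concepts $C ::= A\mid\top\mid C\sqcap C\mid (\geq k\,R.C)$ with $A$ a concept name, $R$ a role name, $k\ge 1$ (numbers written in binary), interpreted in the standard way: $(\geq k\,R.C)^{\mathcal I}$ is the set of elements with at least $k$ pairwise distinct $R$-successors in $C^{\mathcal I}$. $\models C\sqsubseteq C'$ means $C^{\mathcal I}\subseteq C'^{\mathcal I}$ in every interpretation $\mathcal I$. Running time is measured in $|C|+|C'|$, the number of symbols. *)

theory Defs
  imports "HOL-Computational_Algebra.Polynomial" "HOL-Library.Countable_Set"
begin

section \<open>Syntax and semantics\<close>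

text \<open>Concept names and role names are the members of two countably infinite sets, indexed by binary
  words.  Number restrictions use the type \<^typ>\<open>num\<close> of binary numerals, whose values are
  exactly the integers \<open>k \<ge> 1\<close>.\<close>

type_synonym name = "bool list"

datatype concept =
    Atom name
  | Top
  | And concept concept
  | AtLeast num name concept

record 'd interp =
  domain :: "'d set"
  conc :: "name \<Rightarrow> 'd set"
  role :: "name \<Rightarrow> ('d \<times> 'd) set"

definition is_interp :: "'d interp \<Rightarrow> bool" where
  "is_interp I \<longleftrightarrow> domain I \<noteq> {} \<and> (\<forall>A. conc I A \<subseteq> domain I) \<and>
     (\<forall>R. role I R \<subseteq> domain I \<times> domain I)"

primrec extension :: "'d interp \<Rightarrow> concept \<Rightarrow> 'd set" where
  "extension I (Atom A) = conc I A"
| "extension I Top = domain I"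
| "extension I (And C D) = extension I C \<inter> extension I D"
| "extension I (AtLeast k R C) =
     {x \<in> domain I. \<exists>S. S \<subseteq> {y. (x, y) \<in> role I R \<and> y \<in> extension I C} \<and> finite S \<and> card S = numeral k}"

text \<open>A formula cannot quantify over all types, so the domains range over the nonempty sets of
  natural numbers.  This is no restriction: by \<open>subsumed_iff\<close> below, interpretations over any
  other infinite type give the same relation, and by \<open>subsumed_extension\<close> a subsumption that holds
  here holds in the interpretations over every type.\<close>

definition subsumed :: "concept \<Rightarrow> concept \<Rightarrow> bool" where
  "subsumed C D \<longleftrightarrow> (\<forall>I :: nat interp. is_interp I \<longrightarrow> extension I C \<subseteq> extension I D)"

instance num :: countable by countable_datatype
instance concept :: countable by countable_datatype

lemma extension_transfer:
  fixes I :: "'d interp" and f :: "'d \<Rightarrow> 'e"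
  assumes I: "is_interp I" and S: "S \<subseteq> domain I" and inj: "inj_on f S"
    and closed: "\<And>x k R C. x \<in> S \<Longrightarrow> x \<in> extension I (AtLeast k R C) \<Longrightarrow>
      \<exists>T\<subseteq>S. T \<subseteq> {y. (x, y) \<in> role I R \<and> y \<in> extension I C} \<and> finite T \<and> card T = numeral k"
  defines "J \<equiv> \<lparr>domain = f ` S, conc = (\<lambda>A. f ` (conc I A \<inter> S)),
                role = (\<lambda>R. map_prod f f ` (role I R \<inter> S \<times> S))\<rparr>"
  shows "extension J C = f ` (extension I C \<inter> S)"
proof (induction C)
  case (Atom A)
  show ?case by (simp add: J_def)
next
  case Top
  show ?case using S by (simp add: J_def Int_absorb1)
next
  case (And C D)
  have "f ` (extension I C \<inter> S) \<inter> f ` (extension I D \<inter> S)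
      = f ` ((extension I C \<inter> S) \<inter> (extension I D \<inter> S))"
    using inj_on_image_Int[OF inj, of "extension I C \<inter> S" "extension I D \<inter> S"] by simp
  then show ?case using And by (simp add: Int_ac)
next
  case (AtLeast k R C)
  have succ: "{z. (f x, z) \<in> role J R \<and> z \<in> extension J C} =
      f ` ({y. (x, y) \<in> role I R \<and> y \<in> extension I C} \<inter> S)" if "x \<in> S" for x
  proof -
    have role: "(f x, z) \<in> role J R \<longleftrightarrow> (\<exists>y\<in>S. z = f y \<and> (x, y) \<in> role I R)" for z
    proof
      assume "(f x, z) \<in> role J R"
      then obtain u v where uv: "(u, v) \<in> role I R" "u \<in> S" "v \<in> S" "f x = f u" "z = f v"
        by (auto simp: J_def)
      then have "u = x" using inj_onD[OF inj] that by metis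
      then show "\<exists>y\<in>S. z = f y \<and> (x, y) \<in> role I R" using uv by blast
    next
      assume "\<exists>y\<in>S. z = f y \<and> (x, y) \<in> role I R"
      then obtain y where y: "y \<in> S" "z = f y" "(x, y) \<in> role I R" by blast
      then have "(x, y) \<in> role I R \<inter> S \<times> S" using that by blast
      then have "map_prod f f (x, y) \<in> role J R" unfolding J_def by (simp only: interp.simps imageI)
      then show "(f x, z) \<in> role J R" using y by simp
    qed
    have ext: "f y \<in> extension J C \<longleftrightarrow> y \<in> extension I C" if "y \<in> S" for y
      using that inj_onD[OF inj] unfolding AtLeast by blast
    show ?thesis unfolding role using ext by blast
  qed
  have "f x \<in> extension J (AtLeast k R C) \<longleftrightarrow> x \<in> extension I (AtLeast k R C)" if x: "x \<in> S" for x
  proof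
    assume "f x \<in> extension J (AtLeast k R C)"
    then obtain T where T: "T \<subseteq> f ` ({y. (x, y) \<in> role I R \<and> y \<in> extension I C} \<inter> S)"
        "finite T" "card T = numeral k"
      using succ[OF x] by auto
    then obtain U where U: "U \<subseteq> {y. (x, y) \<in> role I R \<and> y \<in> extension I C} \<inter> S" "T = f ` U"
      by (auto simp: subset_image_iff)
    have "inj_on f U" using U inj by (meson inj_on_subset le_infE)
    then have "finite U" "card U = numeral k"
      using T U by (auto simp: finite_image_iff card_image)
    then show "x \<in> extension I (AtLeast k R C)" using U x S by auto
  next
    assume "x \<in> extension I (AtLeast k R C)"
    then obtain T where T: "T \<subseteq> S" "T \<subseteq> {y. (x, y) \<in> role I R \<and> y \<in> extension I C}"
        "finite T" "card T = numeral k"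
      using closed[OF x, of k R C] by blast
    have "card (f ` T) = numeral k" using T inj by (metis card_image inj_on_subset)
    moreover have "f ` T \<subseteq> {z. (f x, z) \<in> role J R \<and> z \<in> extension J C}"
      unfolding succ[OF x] using T by blast
    moreover have "f x \<in> domain J" using x by (simp add: J_def)
    ultimately show "f x \<in> extension J (AtLeast k R C)"
      unfolding extension.simps mem_Collect_eq using finite_imageI[OF T(3), of f] by blast
  qed
  moreover have "extension J (AtLeast k R C) \<subseteq> f ` S" by (auto simp: J_def)
  ultimately show ?case by blast
qed

lemma extension_subset_domain: "is_interp I \<Longrightarrow> extension I C \<subseteq> domain I"
  by (induction C) (auto simp: is_interp_def)

lemma subsumed_extension:
  fixes I :: "'d interp"
  assumes sub: "subsumed C D" and I: "is_interp I"
  shows "extension I C \<subseteq> extension I D"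
proof
  fix x assume xC: "x \<in> extension I C"
  define W where "W = (\<lambda>y (k, R, E). if y \<in> extension I (AtLeast k R E) then
      (SOME T. T \<subseteq> {z. (y, z) \<in> role I R \<and> z \<in> extension I E} \<and> finite T \<and> card T = numeral k) else {})"
  have W: "W y (k, R, E) \<subseteq> {z. (y, z) \<in> role I R \<and> z \<in> extension I E} \<and> finite (W y (k, R, E)) \<and>
      card (W y (k, R, E)) = numeral k" if "y \<in> extension I (AtLeast k R E)" for y k R E
  proof -
    have "\<exists>T. T \<subseteq> {z. (y, z) \<in> role I R \<and> z \<in> extension I E} \<and> finite T \<and> card T = numeral k"
      using that by simp
    from someI_ex[OF this] show ?thesis using that unfolding W_def by (simp only: prod.case if_True)
  qed
  have Wfin: "finite (W y t) \<and> W y t \<subseteq> domain I" for y t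
  proof (cases t)
    case (fields k R E)
    show ?thesis
    proof (cases "y \<in> extension I (AtLeast k R E)")
      case True
      then show ?thesis using W[OF True] fields extension_subset_domain[OF I, of E] by blast
    next
      case False
      then show ?thesis using fields by (simp add: W_def del: extension.simps)
    qed
  qed
  define F where "F = (\<lambda>n. ((\<lambda>X. \<Union>y\<in>X. \<Union>t. W y t) ^^ n) {x})"
  define S where "S = (\<Union>n. F n)"
  have FS: "F (Suc n) = (\<Union>y\<in>F n. \<Union>t. W y t)" for n by (simp add: F_def)
  have "countable (F n) \<and> F n \<subseteq> domain I" for n
  proof (induction n)
    case 0
    show ?case using xC extension_subset_domain[OF I] by (auto simp: F_def)
  next
    case (Suc n)
    then have "countable (F (Suc n))"
      using Wfin unfolding FS by (intro countable_UN) (simp_all add: countable_finite)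
    moreover have "F (Suc n) \<subseteq> domain I" using Wfin unfolding FS by blast
    ultimately show ?case by blast
  qed
  then have S: "countable S" "S \<subseteq> domain I" by (auto simp: S_def)
  have xS: "x \<in> S" unfolding S_def F_def by (rule UN_I[of 0]) auto
  have SW: "W y t \<subseteq> S" if yS: "y \<in> S" for y t
  proof -
    obtain n where "y \<in> F n" using yS by (auto simp: S_def)
    then have "W y t \<subseteq> F (Suc n)" unfolding FS by blast
    then show ?thesis by (auto simp: S_def)
  qed
  define f where "f = to_nat_on S"
  have inj: "inj_on f S" unfolding f_def using S(1) by (rule inj_on_to_nat_on)
  define J where "J = \<lparr>domain = f ` S, conc = (\<lambda>A. f ` (conc I A \<inter> S)),
                role = (\<lambda>R. map_prod f f ` (role I R \<inter> S \<times> S))\<rparr>"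
  have eq: "extension J E = f ` (extension I E \<inter> S)" for E
    unfolding J_def
  proof (rule extension_transfer[OF I S(2) inj])
    fix y k R E assume "y \<in> S" "y \<in> extension I (AtLeast k R E)"
    then show "\<exists>T\<subseteq>S. T \<subseteq> {z. (y, z) \<in> role I R \<and> z \<in> extension I E} \<and> finite T \<and> card T = numeral k"
      using SW[of y "(k, R, E)"] W[of y k R E] by blast
  qed
  have "is_interp J" using xS by (auto simp: is_interp_def J_def)
  then have "extension J C \<subseteq> extension J D" using sub by (simp add: subsumed_def)
  then have "f x \<in> f ` (extension I D \<inter> S)" using xC xS unfolding eq by blast
  then show "x \<in> extension I D" using inj xS by (auto simp: inj_on_eq_iff)
qed

lemma subsumed_iff:
  assumes inf: "infinite (UNIV :: 'd set)"
  shows "subsumed C D \<longleftrightarrow> (\<forall>I :: 'd interp. is_interp I \<longrightarrow> extension I C \<subseteq> extension I D)"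
proof
  assume "subsumed C D"
  then show "\<forall>I :: 'd interp. is_interp I \<longrightarrow> extension I C \<subseteq> extension I D"
    using subsumed_extension by blast
next
  assume R: "\<forall>I :: 'd interp. is_interp I \<longrightarrow> extension I C \<subseteq> extension I D"
  obtain f :: "nat \<Rightarrow> 'd" where f: "inj f" using inf by (meson infinite_countable_subset)
  show "subsumed C D"
    unfolding subsumed_def
  proof (intro allI impI)
    fix I :: "nat interp" assume I: "is_interp I"
    define S where "S = domain I"
    define J where "J = \<lparr>domain = f ` S, conc = (\<lambda>A. f ` (conc I A \<inter> S)),
                role = (\<lambda>R. map_prod f f ` (role I R \<inter> S \<times> S))\<rparr>"
    have inj: "inj_on f S" using f by (meson inj_on_subset subset_UNIV)
    have eq: "extension J E = f ` (extension I E \<inter> S)" for E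
      unfolding J_def
    proof (rule extension_transfer[OF I _ inj])
      show "S \<subseteq> domain I" by (simp add: S_def)
      fix y k R E assume "y \<in> S" "y \<in> extension I (AtLeast k R E)"
      then obtain T where T: "T \<subseteq> {z. (y, z) \<in> role I R \<and> z \<in> extension I E}" "finite T" "card T = numeral k"
        by auto
      moreover have "T \<subseteq> S" using T(1) extension_subset_domain[OF I, of E] by (auto simp: S_def)
      ultimately show "\<exists>T\<subseteq>S. T \<subseteq> {z. (y, z) \<in> role I R \<and> z \<in> extension I E} \<and> finite T \<and> card T = numeral k"
        by blast
    qed
    have "is_interp J" using I by (auto simp: is_interp_def J_def S_def)
    then have "extension J C \<subseteq> extension J D" using R by blast
    then have "extension I C \<inter> S \<subseteq> extension I D \<inter> S"
      unfolding eq using inj_image_subset_iff[OF f] by simp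
    then show "extension I C \<subseteq> extension I D"
      using extension_subset_domain[OF I, of C] by (auto simp: S_def)
  qed
qed


section \<open>Concepts as words\<close>

text \<open>A concept is written over a finite alphabet as \<open>A\<^bsub>w\<^esub>\<close>, \<open>\<top>\<close>, \<open>(C \<sqinter> D)\<close> or \<open>(\<ge> k R\<^bsub>w\<^esub>. C)\<close>,
  with \<open>w\<close> and \<open>k\<close> in binary.\<close>

datatype letter = Dig bool | LConc | LRole | LTop | LAnd | LGeq | LDot | LOpen | LClose | LSub

text \<open>Most significant digit first.\<close>

primrec digits :: "num \<Rightarrow> bool list" where
  "digits num.One = [True]"
| "digits (num.Bit0 k) = digits k @ [False]"
| "digits (num.Bit1 k) = digits k @ [True]"

primrec word_of :: "concept \<Rightarrow> letter list" where
  "word_of (Atom A) = LConc # map Dig A"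
| "word_of Top = [LTop]"
| "word_of (And C D) = [LOpen] @ word_of C @ [LAnd] @ word_of D @ [LClose]"
| "word_of (AtLeast k R C) =
     [LOpen, LGeq] @ map Dig (digits k) @ [LRole] @ map Dig R @ [LDot] @ word_of C @ [LClose]"

definition csize :: "concept \<Rightarrow> nat" where
  "csize C = length (word_of C)"

definition input_word :: "concept \<Rightarrow> concept \<Rightarrow> letter list" where
  "input_word C D = word_of C @ [LSub] @ word_of D"


section \<open>Deterministic multi-tape Turing machines\<close>

datatype 'a cell = Blank | Input 'a | Work nat

datatype move = MLeft | MStay | MRight

record 'a tm =
  tapes :: nat
  states :: "nat set"
  alphabet :: "'a cell set"
  start :: nat
  accept :: nat
  reject :: nat
  delta :: "nat \<Rightarrow> 'a cell list \<Rightarrow> nat \<times> ('a cell \<times> move) list"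

definition turing_machine :: "'a tm \<Rightarrow> bool" where
  "turing_machine M \<longleftrightarrow>
     tapes M \<ge> 1 \<and> finite (states M) \<and> finite (alphabet M) \<and>
     {start M, accept M, reject M} \<subseteq> states M \<and> accept M \<noteq> reject M \<and>
     Blank \<in> alphabet M \<and> range Input \<subseteq> alphabet M \<and>
     (\<forall>q\<in>states M. \<forall>cs. length cs = tapes M \<and> set cs \<subseteq> alphabet M \<longrightarrow>
        (case delta M q cs of (q', as) \<Rightarrow>
           q' \<in> states M \<and> length as = tapes M \<and> fst ` set as \<subseteq> alphabet M))"

text \<open>Tapes are infinite in both directions; the second component is the head position.\<close>

type_synonym 'a tape = "(int \<Rightarrow> 'a cell) \<times> int"

type_synonym 'a config = "nat \<times> 'a tape list"

fun scanned :: "'a tape \<Rightarrow> 'a cell" where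
  "scanned (t, h) = t h"

fun shift :: "move \<Rightarrow> int \<Rightarrow> int" where
  "shift MLeft h = h - 1"
| "shift MStay h = h"
| "shift MRight h = h + 1"

fun act :: "'a cell \<times> move \<Rightarrow> 'a tape \<Rightarrow> 'a tape" where
  "act (c, m) (t, h) = (t(h := c), shift m h)"

fun step :: "'a tm \<Rightarrow> 'a config \<Rightarrow> 'a config" where
  "step M (q, ts) =
     (if q = accept M \<or> q = reject M then (q, ts)
      else case delta M q (map scanned ts) of (q', as) \<Rightarrow> (q', map2 act as ts))"

definition input_tape :: "'a list \<Rightarrow> 'a tape" where
  "input_tape w = ((\<lambda>i. if 0 \<le> i \<and> i < int (length w) then Input (w ! nat i) else Blank), 0)"

definition initial :: "'a tm \<Rightarrow> 'a list \<Rightarrow> 'a config" where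
  "initial M w = (start M, input_tape w # replicate (tapes M - 1) (input_tape []))"

definition accepts_within :: "'a tm \<Rightarrow> 'a list \<Rightarrow> nat \<Rightarrow> bool" where
  "accepts_within M w n \<longleftrightarrow> (\<exists>t\<le>n. fst ((step M ^^ t) (initial M w)) = accept M)"

definition rejects_within :: "'a tm \<Rightarrow> 'a list \<Rightarrow> nat \<Rightarrow> bool" where
  "rejects_within M w n \<longleftrightarrow> (\<exists>t\<le>n. fst ((step M ^^ t) (initial M w)) = reject M)"

end

theory Submission imports Defs begin

text \<open>\<open>C \<sqsubseteq> D\<close> holds iff every conjunct of \<open>D\<close> is matched by a single conjunct of \<open>C\<close>: a name by the
  same name, and \<open>\<ge> k R. D'\<close> by some \<open>\<ge> l R. C'\<close> with \<open>k \<le> l\<close> and \<open>C' \<sqsubseteq> D'\<close>.  Restrictions of \<open>C\<close> do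
  not add up, because successors required by different conjuncts may be shared; one universal
  interpretation, whose elements each refute a single conjunct and are otherwise as permissive as
  possible, contains all counterexamples.

  This recursion visits each pair of subconcept occurrences at most once.  Since the word of a
  concept determines the parent and the siblings of each occurrence, a machine with one head on each
  concept needs no recursion stack: it walks through the pairs, using a unary counter to match
  parentheses, so that every visit takes linear time and the whole run takes cubic time.\<close>

section \<open>Structural characterisation of subsumption\<close>

primrec conjuncts :: "concept \<Rightarrow> concept set" where
  "conjuncts (Atom A) = {Atom A}"
| "conjuncts Top = {}"
| "conjuncts (And C D) = conjuncts C \<union> conjuncts D"
| "conjuncts (AtLeast k R C) = {AtLeast k R C}"

primrec basic :: "concept \<Rightarrow> bool" where
  "basic (Atom A) \<longleftrightarrow> True"
| "basic Top \<longleftrightarrow> False"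
| "basic (And C D) \<longleftrightarrow> False"
| "basic (AtLeast k R C) \<longleftrightarrow> True"

primrec covers :: "concept \<Rightarrow> concept \<Rightarrow> bool" where
  "covers (Atom A) C \<longleftrightarrow> Atom A \<in> conjuncts C"
| "covers Top C \<longleftrightarrow> True"
| "covers (And D E) C \<longleftrightarrow> covers D C \<and> covers E C"
| "covers (AtLeast k R D) C \<longleftrightarrow> (\<exists>l E. AtLeast l R E \<in> conjuncts C \<and> k \<le> l \<and> covers D E)"

lemma basic_if_in_conjuncts: "e \<in> conjuncts C \<Longrightarrow> basic e"
  by (induction C) auto

lemma covers_iff_conjuncts: "covers D C \<longleftrightarrow> (\<forall>e\<in>conjuncts D. covers e C)"
  by (induction D) auto

lemma covers_And_iff: "basic e \<Longrightarrow> covers e (And C D) \<longleftrightarrow> covers e C \<or> covers e D"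
  by (cases e) auto

lemma extension_subset_if_in_conjuncts: "e \<in> conjuncts C \<Longrightarrow> extension I C \<subseteq> extension I e"
  by (induction C) auto

lemma finite_subset_with_card_iff:
  "(\<exists>S\<subseteq>X. finite S \<and> card S = n) \<longleftrightarrow> infinite X \<or> n \<le> card X"
proof
  assume "\<exists>S\<subseteq>X. finite S \<and> card S = n"
  then show "infinite X \<or> n \<le> card X" using card_mono by blast
next
  assume "infinite X \<or> n \<le> card X"
  then show "\<exists>S\<subseteq>X. finite S \<and> card S = n"
  proof
    assume "infinite X"
    then show ?thesis using infinite_arbitrarily_large by blast
  next
    assume "n \<le> card X"
    then show ?thesis using obtain_subset_with_card_n by metis
  qed
qed

lemma extension_AtLeast_iff:
  fixes I :: "'d interp" and x :: 'd and R :: name and C :: concept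
  defines "X \<equiv> {y. (x, y) \<in> role I R \<and> y \<in> extension I C}"
  shows "x \<in> extension I (AtLeast k R C) \<longleftrightarrow> x \<in> domain I \<and> (infinite X \<or> numeral k \<le> card X)"
  unfolding finite_subset_with_card_iff[symmetric] by (simp add: X_def)

lemma extension_AtLeast_mono:
  assumes "k \<le> l" "extension I C \<subseteq> extension I D"
  shows "extension I (AtLeast l R C) \<subseteq> extension I (AtLeast k R D)"
proof
  fix x assume x: "x \<in> extension I (AtLeast l R C)"
  let ?X = "\<lambda>C. {y. (x, y) \<in> role I R \<and> y \<in> extension I C}"
  have "?X C \<subseteq> ?X D" using assms(2) by blast
  then have "infinite (?X D) \<or> finite (?X C) \<and> card (?X C) \<le> card (?X D)"
    by (meson card_mono finite_subset)
  moreover have "(numeral k :: nat) \<le> numeral l" using assms(1) by simp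
  ultimately show "x \<in> extension I (AtLeast k R D)"
    using x unfolding extension_AtLeast_iff by (meson order_trans)
qed

lemma covers_imp_extension_subset:
  assumes "is_interp I"
  shows "covers D C \<Longrightarrow> extension I C \<subseteq> extension I D"
proof (induction D arbitrary: C)
  case (Atom A)
  then show ?case using extension_subset_if_in_conjuncts[of "Atom A" C] by simp
next
  case Top
  then show ?case using extension_subset_domain[OF assms] by simp
next
  case (And D E)
  then show ?case by simp
next
  case (AtLeast k R D)
  then obtain l E where matching: "AtLeast l R E \<in> conjuncts C" "k \<le> l"
    "extension I E \<subseteq> extension I D" by auto
  have "extension I C \<subseteq> extension I (AtLeast l R E)"
    using matching(1) by (rule extension_subset_if_in_conjuncts)
  also have "\<dots> \<subseteq> extension I (AtLeast k R D)" using matching(2,3) by (rule extension_AtLeast_mono)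
  finally show ?case .
qed

text \<open>The element \<open>(Some e, n)\<close> is the most permissive element outside the extension of \<open>e\<close>, and
  \<open>(None, n)\<close> lies in every extension; \<open>n\<close> only provides infinitely many copies.\<close>

fun refuter_succ :: "concept option \<times> nat \<Rightarrow> name \<Rightarrow> (concept option \<times> nat) set" where
  "refuter_succ (Some (AtLeast k R D), n) S =
     (if S = R then {None} \<times> {..<numeral k - 1} \<union> Some ` conjuncts D \<times> UNIV else UNIV)"
| "refuter_succ _ S = UNIV"

definition refuter_model :: "(concept option \<times> nat) interp" where
  "refuter_model = \<lparr>domain = UNIV, conc = (\<lambda>A. {x. fst x \<noteq> Some (Atom A)}),
     role = (\<lambda>S. {(x, y). y \<in> refuter_succ x S})\<rparr>"

lemma refuter_model_simps [simp]:
  "domain refuter_model = UNIV"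
  "x \<in> conc refuter_model A \<longleftrightarrow> fst x \<noteq> Some (Atom A)"
  "(x, y) \<in> role refuter_model S \<longleftrightarrow> y \<in> refuter_succ x S"
  by (simp_all add: refuter_model_def)

lemma is_interp_refuter_model: "is_interp refuter_model"
  by (simp add: is_interp_def refuter_model_def)

lemma in_extension_refuter_AtLeast_iff:
  "x \<in> extension refuter_model (AtLeast k R C) \<longleftrightarrow>
    infinite (refuter_succ x R \<inter> extension refuter_model C) \<or>
    numeral k \<le> card (refuter_succ x R \<inter> extension refuter_model C)"
  unfolding extension_AtLeast_iff by (simp add: Int_def)

lemma infinite_if_times_UNIV_subset: "{x} \<times> (UNIV :: nat set) \<subseteq> X \<Longrightarrow> infinite X"
  using finite_subset by (fastforce simp: finite_cartesian_product_iff)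

lemma None_in_extension: "(None, n) \<in> extension refuter_model C"
proof (induction C arbitrary: n)
  case (AtLeast k R C)
  then have "{None} \<times> UNIV \<subseteq> refuter_succ (None, n) R \<inter> extension refuter_model C" by auto
  then show ?case
    unfolding in_extension_refuter_AtLeast_iff by (intro disjI1 infinite_if_times_UNIV_subset)
qed auto

lemma refuter_not_in_extension: "e \<in> conjuncts D \<Longrightarrow> (Some e, n) \<notin> extension refuter_model D"
proof (induction D arbitrary: e n)
  case (AtLeast k R D)
  have "refuter_succ (Some (AtLeast k R D), n) R \<inter> extension refuter_model D
      = {None} \<times> {..<numeral k - 1}"
    using AtLeast.IH None_in_extension by auto
  moreover have "numeral k - 1 < (numeral k :: nat)"
    by (intro diff_less zero_less_one zero_less_numeral)
  ultimately show ?case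
    using AtLeast.prems unfolding in_extension_refuter_AtLeast_iff
    by (simp add: card_cartesian_product)
qed auto

lemma refuter_in_extension:
  "basic e \<Longrightarrow> \<not> covers e C \<Longrightarrow> (Some e, n) \<in> extension refuter_model C"
proof (induction C arbitrary: e n)
  case (AtLeast l S E)
  let ?X = "refuter_succ (Some e, n) S \<inter> extension refuter_model E"
  consider (unrestricted) "refuter_succ (Some e, n) S = UNIV"
    | (restricted) k D where "e = AtLeast k S D"
    by (cases "\<exists>k D. e = AtLeast k S D"; cases e) auto
  then have "infinite ?X \<or> numeral l \<le> card ?X"
  proof cases
    case unrestricted
    then have "{None} \<times> UNIV \<subseteq> ?X" using None_in_extension by auto
    then show ?thesis by (intro disjI1 infinite_if_times_UNIV_subset)
  next
    case restricted
    show ?thesis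
    proof (cases "covers D E")
      case True
      then have "(numeral l :: nat) < numeral k" using AtLeast.prems restricted by auto
      then have "(numeral l :: nat) \<le> card ({None :: concept option} \<times> {..<numeral k - 1 :: nat})"
        by (simp add: card_cartesian_product numeral_eq_Suc)
      moreover have "{None} \<times> {..<numeral k - 1} \<subseteq> ?X" using restricted None_in_extension by auto
      ultimately show ?thesis by (meson card_mono order_trans)
    next
      case False
      then obtain f where "f \<in> conjuncts D" "\<not> covers f E" using covers_iff_conjuncts by blast
      then have "{Some f} \<times> UNIV \<subseteq> ?X"
        using restricted AtLeast.IH basic_if_in_conjuncts by auto
      then show ?thesis by (intro disjI1 infinite_if_times_UNIV_subset)
    qed
  qed
  then show ?case unfolding in_extension_refuter_AtLeast_iff .
qed (auto simp: covers_And_iff)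

theorem subsumed_iff_covers: "subsumed C D \<longleftrightarrow> covers D C"
proof
  assume "subsumed C D"
  then have sub: "extension refuter_model C \<subseteq> extension refuter_model D"
    by (rule subsumed_extension[OF _ is_interp_refuter_model])
  have "covers e C" if "e \<in> conjuncts D" for e
    using that sub basic_if_in_conjuncts refuter_in_extension refuter_not_in_extension by blast
  then show "covers D C" using covers_iff_conjuncts by blast
next
  assume "covers D C"
  then show "subsumed C D" unfolding subsumed_def using covers_imp_extension_subset by blast
qed


section \<open>Words on tapes and timed runs\<close>

definition reaches :: "'a tm \<Rightarrow> nat \<Rightarrow> 'a config \<Rightarrow> 'a config \<Rightarrow> bool" where
  "reaches M n a b \<longleftrightarrow> (\<exists>m\<le>n. (step M ^^ m) a = b)"

lemma reaches_refl: "reaches M 0 a a"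
  by (simp add: reaches_def)

lemma reaches_step: "step M a = b \<Longrightarrow> reaches M 1 a b"
  unfolding reaches_def by (intro exI[of _ 1]) simp

lemma reaches_trans [trans]: "reaches M m a b \<Longrightarrow> reaches M n b c \<Longrightarrow> reaches M (m + n) a c"
  unfolding reaches_def
proof (elim exE conjE)
  fix p q assume "p \<le> m" "(step M ^^ p) a = b" "q \<le> n" "(step M ^^ q) b = c"
  then show "\<exists>r\<le>m + n. (step M ^^ r) a = c"
    by (intro exI[of _ "q + p"]) (simp add: funpow_add)
qed

lemma reaches_mono: "reaches M m a b \<Longrightarrow> m \<le> n \<Longrightarrow> reaches M n a b"
  unfolding reaches_def using le_trans by blast

lemma accepts_within_if_reaches:
  "reaches M n (initial M w) c \<Longrightarrow> fst c = accept M \<Longrightarrow> accepts_within M w n"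
  by (auto simp: reaches_def accepts_within_def)

lemma rejects_within_if_reaches:
  "reaches M n (initial M w) c \<Longrightarrow> fst c = reject M \<Longrightarrow> rejects_within M w n"
  by (auto simp: reaches_def rejects_within_def)

definition word_at :: "(int \<Rightarrow> 'a cell) \<Rightarrow> int \<Rightarrow> 'a list \<Rightarrow> bool" where
  "word_at t i u \<longleftrightarrow> (\<forall>m<length u. t (i + int m) = Input (u ! m))"

lemma word_at_Nil [simp]: "word_at t i []"
  by (simp add: word_at_def)

lemma word_at_Cons [simp]: "word_at t i (a # u) \<longleftrightarrow> t i = Input a \<and> word_at t (i + 1) u"
  by (auto simp: word_at_def less_Suc_eq_0_disj algebra_simps)

lemma word_at_append [simp]:
  "word_at t i (u @ v) \<longleftrightarrow> word_at t i u \<and> word_at t (i + int (length u)) v"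
  by (induction u arbitrary: i) (auto simp: algebra_simps)

abbreviation input_cells :: "'a list \<Rightarrow> int \<Rightarrow> 'a cell" where
  "input_cells w \<equiv> fst (input_tape w)"

lemma word_at_input_cells: "word_at (input_cells w) 0 w"
  by (simp add: word_at_def input_tape_def)

lemma input_cells_outside: "i < 0 \<or> int (length w) \<le> i \<Longrightarrow> input_cells w i = Blank"
  by (auto simp: input_tape_def)

lemma input_cells_snoc: "(input_cells u)(int (length u) := Input a) = input_cells (u @ [a])"
  by (auto simp: input_tape_def fun_eq_iff nth_append)


section \<open>The words of concepts\<close>

lemma csize_simps [simp]:
  "csize (Atom A) = Suc (length A)"
  "csize Top = 1"
  "csize (And C D) = csize C + csize D + 3"
  "csize (AtLeast k R C) = length (digits k) + length R + csize C + 5"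
  by (simp_all add: csize_def)

lemma csize_pos: "0 < csize C"
  by (cases C) auto

lemma le_mult_csize: "n \<le> K \<Longrightarrow> n \<le> K * csize C"
  using csize_pos[of C] by (cases "csize C") (simp_all add: trans_le_add1)

lemma hd_word_of: "hd (word_of C) \<in> {LConc, LTop, LOpen}"
  by (cases C) auto

lemma word_of_neq_Nil: "word_of C \<noteq> []"
  by (cases C) auto

lemma LSub_notin_word_of: "LSub \<notin> set (word_of C)"
  by (induction C) auto

primrec header :: "concept \<Rightarrow> letter list" where
  "header (Atom A) = LConc # map Dig A"
| "header Top = [LTop]"
| "header (And C D) = [LOpen]"
| "header (AtLeast k R C) =
     [LOpen, LGeq] @ map Dig (digits k) @ [LRole] @ map Dig R @ [LDot]"

lemma header_prefix_word_of: "\<exists>u. word_of C = header C @ u"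
  by (cases C) auto

lemma length_header_le: "length (header C) \<le> csize C"
  by (cases C) auto

lemma header_nth_iff:
  assumes "basic e" "m < length (header e)"
  shows "header e ! m \<in> {LOpen, LConc} \<longleftrightarrow> m = 0"
proof (cases m)
  case 0
  then show ?thesis using assms by (cases e) auto
next
  case (Suc n)
  have "set (tl (header e)) \<inter> {LOpen, LConc} = {}" using assms(1) by (cases e) auto
  moreover have "header e ! m \<in> set (tl (header e))"
    using assms(2) Suc by (simp add: nth_tl[symmetric])
  ultimately show ?thesis using Suc by blast
qed

text \<open>The last conjunct says that the word read at \<open>i\<close> is not continued by digits or a dot, so that
  the end of a name can be recognised.\<close>

definition occurs :: "(int \<Rightarrow> letter cell) \<Rightarrow> int \<Rightarrow> concept \<Rightarrow> bool" where
  "occurs t i C \<longleftrightarrow> word_at t i (word_of C) \<and>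
     t (i + int (csize C)) \<in> {Blank, Input LAnd, Input LClose, Input LSub}"

lemma occurs_hd: "occurs t i C \<Longrightarrow> t i = Input (hd (word_of C))"
  using word_of_neq_Nil[of C] by (cases "word_of C") (auto simp: occurs_def)

lemma occurs_header_cell_iff:
  assumes "basic e" "occurs t i e" "m < length (header e)"
  shows "t (i + int m) \<in> {Input LOpen, Input LConc} \<longleftrightarrow> m = 0"
proof -
  have "word_at t i (header e)"
    using assms(2) header_prefix_word_of[of e] by (auto simp: occurs_def)
  then have "t (i + int m) = Input (header e ! m)" using assms(3) by (simp add: word_at_def)
  then show ?thesis using header_nth_iff[OF assms(1,3)] by simp
qed

lemma occurs_AndD:
  assumes "occurs t i (And C D)"
  shows "t i = Input LOpen"
    and "occurs t (i + 1) C"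
    and "t (i + int (csize C) + 1) = Input LAnd"
    and "occurs t (i + int (csize C) + 2) D"
  using assms by (auto simp: occurs_def csize_def algebra_simps)

lemma occurs_AtLeastD:
  assumes "occurs t i (AtLeast k R C)"
  shows "t i = Input LOpen"
    and "t (i + 1) = Input LGeq"
    and "word_at t (i + 2) (map Dig (digits k) @ [LRole])"
    and "word_at t (i + 3 + int (length (digits k))) (map Dig R @ [LDot])"
    and "occurs t (i + 4 + int (length (digits k)) + int (length R)) C"
  using assms by (auto simp: occurs_def csize_def algebra_simps)


subsection \<open>Nesting of parentheses\<close>

primrec nesting :: "letter list \<Rightarrow> int" where
  "nesting [] = 0"
| "nesting (a # u) = (if a = LOpen then 1 else if a = LClose then - 1 else 0) + nesting u"

lemma nesting_append [simp]: "nesting (u @ v) = nesting u + nesting v"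
  by (induction u) auto

lemma nesting_digits [simp]: "nesting (map Dig u) = 0"
  by (induction u) auto

lemma nesting_word_of [simp]: "nesting (word_of C) = 0"
  by (induction C) auto

text \<open>The scans \<open>Sibling\<close> and \<open>Parent\<close> below stop at a letter \<open>c\<close> met with the counter at \<open>0\<close>; the
  shielded words are those that they cross.\<close>

primrec shielded :: "letter \<Rightarrow> int \<Rightarrow> letter list \<Rightarrow> bool" where
  "shielded c k [] \<longleftrightarrow> True"
| "shielded c k (a # u) \<longleftrightarrow> (a = c \<longrightarrow> k \<noteq> 0) \<and> shielded c (k + nesting [a]) u"

lemma shielded_append [simp]:
  "shielded c k (u @ v) \<longleftrightarrow> shielded c k u \<and> shielded c (k + nesting u) v"
  by (induction u arbitrary: k) (auto simp: add.assoc)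

lemma shielded_digits [simp]: "c \<notin> range Dig \<Longrightarrow> shielded c k (map Dig u)"
  by (induction u) auto

lemma shielded_LAnd_word_of: "0 \<le> k \<Longrightarrow> shielded LAnd k (word_of C)"
  by (induction C arbitrary: k) (auto simp: image_iff)

lemma shielded_LOpen_word_of: "0 < k \<Longrightarrow> shielded LOpen k (word_of C)"
  by (induction C arbitrary: k) (auto simp: image_iff)


subsection \<open>Comparison of binary numerals\<close>

text \<open>The first argument is the outcome for the digits read so far if both numerals have the same
  length: \<open>None\<close> for equality, and \<open>Some True\<close> if the first numeral is larger.\<close>

fun compare_digits :: "bool option \<Rightarrow> bool list \<Rightarrow> bool list \<Rightarrow> bool option" where
  "compare_digits c [] [] = c"
| "compare_digits c (a # u) [] = compare_digits (Some True) u []"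
| "compare_digits c [] (b # v) = compare_digits (Some False) [] v"
| "compare_digits c (a # u) (b # v) = compare_digits (if c = None \<and> a \<noteq> b then Some a else c) u v"

lemma compare_digits_same_length:
  "length u = length v \<Longrightarrow> compare_digits None u v \<noteq> Some False \<longleftrightarrow> lexordp_eq v u"
proof (induction u v rule: list_induct2)
  case (Cons a u b v)
  have "compare_digits (Some d) u v = Some d" for d
    using Cons.hyps by (induction u v rule: list_induct2) auto
  then show ?case using Cons.IH by auto
qed simp

lemma compare_digits_longer: "length v < length u \<Longrightarrow> compare_digits c u v = Some True"
proof (induction c u v rule: compare_digits.induct)
  case (2 c a u)
  then show ?case by (cases u) auto
qed auto

lemma compare_digits_shorter: "length u < length v \<Longrightarrow> compare_digits c u v = Some False"
proof (induction c u v rule: compare_digits.induct)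
  case (3 c b v)
  then show ?case by (cases v) auto
qed auto

lemma horner_sum_digits: "horner_sum of_bool 2 (rev (digits k)) = (numeral k :: nat)"
  by (induction k) (simp_all add: numeral_Bit0 numeral_Bit1)

lemma digits_eq_True_Cons: "\<exists>u. digits k = True # u"
  by (induction k) auto

lemma length_digits_mono: "l \<le> k \<Longrightarrow> length (digits l) \<le> length (digits k)"
proof (rule ccontr)
  assume "l \<le> k" and longer: "\<not> length (digits l) \<le> length (digits k)"
  obtain u where u: "digits l = True # u" using digits_eq_True_Cons by blast
  have "numeral k < (2::nat) ^ length (digits k)"
    using horner_sum_of_bool_2_less[of "rev (digits k)", where 'a = nat]
    by (simp add: horner_sum_digits)
  also have "\<dots> \<le> 2 ^ length u" using longer u by (intro power_increasing) auto
  also have "\<dots> \<le> horner_sum of_bool 2 (rev (digits l))" using u by (simp add: horner_sum_append)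
  finally show False using \<open>l \<le> k\<close> by (simp add: horner_sum_digits)
qed

lemma compare_digits_iff:
  "compare_digits None (digits l) (digits k) \<noteq> Some False \<longleftrightarrow> k \<le> l"
proof (cases "length (digits l)" "length (digits k)" rule: linorder_cases)
  case less
  then show ?thesis using length_digits_mono[of k l] by (auto simp: compare_digits_shorter)
next
  case equal
  then have "lexordp_eq (digits k) (digits l) \<longleftrightarrow> (numeral k :: nat) \<le> numeral l"
    using horner_sum_less_eq_iff_lexordp_eq[of "rev (digits k)" "rev (digits l)", where 'a = nat]
    by (simp add: horner_sum_digits)
  then show ?thesis using equal by (simp add: compare_digits_same_length)
next
  case greater
  then show ?thesis
    using length_digits_mono[of l k] linear[of k l] by (auto simp: compare_digits_longer)
qed


section \<open>The Turing machine\<close>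

datatype side = Lhs | Rhs

lemma all_side_iff: "(\<forall>s. P s) \<longleftrightarrow> P Lhs \<and> P Rhs"
  by (metis side.exhaust)

datatype control =
    Start | Copy | Rewind
  | Visit side | Open side | Conjunct side
  | CompareNumbers "bool option" | CompareNames | Back bool
  | Return side bool | ReturnLeft side bool | Sibling side | Parent side bool
  | Accept | Reject

instance side :: countable by countable_datatype
instance control :: countable by countable_datatype

instance side :: finite
proof
  show "finite (UNIV :: side set)"
    by (rule finite_subset[of _ "{Lhs, Rhs}"]) (use side.exhaust in blast, simp)
qed

instance control :: finite
proof
  let ?X = "{Start, Copy, Rewind, CompareNames, Accept, Reject} \<union> range Visit \<union> range Open \<union>
    range Conjunct \<union> range CompareNumbers \<union> range Back \<union> range (case_prod Return) \<union>
    range (case_prod ReturnLeft) \<union> range Sibling \<union> range (case_prod Parent)"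
  have "q \<in> ?X" for q by (cases q) (simp_all add: image_iff)
  then show "finite (UNIV :: control set)" by (intro finite_subset[of UNIV ?X]) auto
qed

instance letter :: finite
proof
  let ?X = "range Dig \<union> {LConc, LRole, LTop, LAnd, LGeq, LDot, LOpen, LClose, LSub}"
  have "a \<in> ?X" for a by (cases a) simp_all
  then show "finite (UNIV :: letter set)" by (intro finite_subset[of UNIV ?X]) auto
qed

definition is_digit :: "letter cell \<Rightarrow> bool" where
  "is_digit x \<longleftrightarrow> (\<exists>b. x = Input (Dig b))"

abbreviation stay :: "side \<Rightarrow> move" where
  "stay \<equiv> \<lambda>_. MStay"

text \<open>The right-hand concept \<open>D\<close> is read on the input tape and the left-hand concept \<open>C\<close> on a copy;
  \<open>x\<close> gives the scanned cells of these two tapes and \<open>z\<close> the one of the counter tape, whose only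
  nonblank cell is the origin.  A node of a concept is addressed by the position of its first
  letter; the letter to the left of that position shows whether the node is the root
  (\<open>LSub\<close> or blank), a left conjunct (\<open>LOpen\<close>), a right conjunct (\<open>LAnd\<close>) or the body of a
  restriction (\<open>LDot\<close>).

  \<open>Visit s\<close> evaluates the node under head \<open>s\<close> and ends in \<open>Return s b\<close> on that node, \<open>b\<close> being the
  verdict.  A conjunction holds on the right if both conjuncts do and on the left if one does, so
  that \<open>b = (s = Lhs)\<close> makes the second conjunct irrelevant; otherwise \<open>Sibling\<close> moves on to it, and
  \<open>Parent\<close> leads back from it to the conjunction.  \<open>Back\<close> leads both heads to the first letters of
  the basic concepts under comparison; the steps to the left that precede it keep the heads from
  stopping at the first letter of a body or leaving the word of an atom.\<close>

primrec transition ::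
  "control \<Rightarrow> (side \<Rightarrow> letter cell) \<Rightarrow> letter cell \<Rightarrow> control \<times> (side \<Rightarrow> move) \<times> move" where
  "transition Start x z = (Copy, stay, MStay)"
| "transition Copy x z =
     (if x Rhs = Input LSub then (Rewind, stay(Lhs := MLeft, Rhs := MRight), MStay)
      else (Copy, (\<lambda>_. MRight), MStay))"
| "transition Rewind x z =
     (if x Lhs = Blank then (Visit Rhs, stay(Lhs := MRight), MStay)
      else (Rewind, stay(Lhs := MLeft), MStay))"
| "transition (Visit s) x z =
     (if x s = Input LOpen then (Open s, stay(s := MRight), MStay)
      else (Conjunct s, stay, MStay))"
| "transition (Open s) x z =
     (if x s = Input LGeq then (Conjunct s, stay(s := MLeft), MStay)
      else (Visit s, stay, MStay))"
| "transition (Conjunct s) x z =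
     (if s = Rhs then
        if x Rhs = Input LTop then (Return Rhs True, stay, MStay) else (Visit Lhs, stay, MStay)
      else if x Lhs \<noteq> x Rhs then (Return Lhs False, stay, MStay)
      else if x Rhs = Input LOpen then (CompareNumbers None, (\<lambda>_. MRight), MStay)
      else (CompareNames, (\<lambda>_. MRight), MStay))"
| "transition (CompareNumbers c) x z =
     (if \<forall>s. x s = Input LRole then
        (if c = Some False then Back False else CompareNames, (\<lambda>_. MRight), MStay)
      else
        (CompareNumbers
          (if x Rhs = Input LRole then Some True
           else if x Lhs = Input LRole then Some False
           else if c = None \<and> x Lhs \<noteq> x Rhs then Some (x Lhs = Input (Dig True)) else c),
         (\<lambda>s. if x s = Input LRole then MStay else MRight), MStay))"
| "transition CompareNames x z =
     (if is_digit (x Lhs) \<and> x Lhs = x Rhs then (CompareNames, (\<lambda>_. MRight), MStay)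
      else if is_digit (x Lhs) \<or> is_digit (x Rhs) then (Back False, (\<lambda>_. MLeft), MStay)
      else if x Lhs = Input LDot then (Visit Rhs, (\<lambda>_. MRight), MStay)
      else (Back True, (\<lambda>_. MLeft), MStay))"
| "transition (Back b) x z =
     (if \<forall>s. x s \<in> {Input LOpen, Input LConc} then (Return Lhs b, stay, MStay)
      else (Back b, (\<lambda>s. if x s \<in> {Input LOpen, Input LConc} then MStay else MLeft), MStay))"
| "transition (Return s b) x z = (ReturnLeft s b, stay(s := MLeft), MStay)"
| "transition (ReturnLeft s b) x z =
     (if x s = Input LOpen then
        if b = (s = Lhs) then (Return s b, stay, MStay) else (Sibling s, stay(s := MRight), MStay)
      else if x s = Input LAnd then (Parent s b, stay(s := MLeft), MStay)
      else if s = Lhs then (Return Rhs b, stay(Lhs := MRight), MStay)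
      else if x Rhs = Input LDot then (Back b, stay(Lhs := MLeft), MStay)
      else (if b then Accept else Reject, stay, MStay))"
| "transition (Sibling s) x z =
     (if x s = Input LAnd \<and> z \<noteq> Blank then (Visit s, stay(s := MRight), MStay)
      else (Sibling s, stay(s := MRight),
        if x s = Input LOpen then MRight else if x s = Input LClose then MLeft else MStay))"
| "transition (Parent s b) x z =
     (if x s = Input LOpen \<and> z \<noteq> Blank then (Return s b, stay, MStay)
      else (Parent s b, stay(s := MLeft),
        if x s = Input LOpen then MLeft else if x s = Input LClose then MRight else MStay))"
| "transition Accept x z = (Accept, stay, MStay)"
| "transition Reject x z = (Reject, stay, MStay)"

definition subsumption_tm :: "letter tm" where
  "subsumption_tm = \<lparr>tapes = 3, states = range (to_nat :: control \<Rightarrow> nat),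
     alphabet = {Blank, Work 0} \<union> range Input,
     start = to_nat Start, accept = to_nat Accept, reject = to_nat Reject,
     delta = (\<lambda>q cs.
       case transition (from_nat q) (\<lambda>s. case s of Rhs \<Rightarrow> cs ! 0 | Lhs \<Rightarrow> cs ! 1) (cs ! 2) of
         (q', m, d) \<Rightarrow>
           (to_nat q',
            [(cs ! 0, m Rhs),
             (if from_nat q = Copy \<and> cs ! 0 \<noteq> Input LSub then cs ! 0 else cs ! 1, m Lhs),
             (if from_nat q = Start then Work 0 else cs ! 2, d)]))\<rparr>"

lemma turing_machine_subsumption_tm: "turing_machine subsumption_tm"
proof -
  have delta: "case delta subsumption_tm q cs of (q', as) \<Rightarrow>
      q' \<in> states subsumption_tm \<and> length as = tapes subsumption_tm \<and>
      fst ` set as \<subseteq> alphabet subsumption_tm"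
    if "length cs = tapes subsumption_tm" and sub: "set cs \<subseteq> alphabet subsumption_tm" for q cs
  proof -
    have "length cs = Suc (Suc (Suc 0))" using that(1) by (simp add: subsumption_tm_def)
    then obtain x y z where "cs = [x, y, z]" by (auto simp: length_Suc_conv)
    then show ?thesis using sub by (auto simp: subsumption_tm_def split: prod.split)
  qed
  show ?thesis
    unfolding turing_machine_def
    by (intro conjI ballI allI impI delta) (auto simp: subsumption_tm_def)
qed

definition origin_mark :: "int \<Rightarrow> letter cell" where
  "origin_mark = (\<lambda>_. Blank)(0 := Work 0)"

lemma origin_mark_Blank [simp]: "origin_mark k = Blank \<longleftrightarrow> k \<noteq> 0"
  by (simp add: origin_mark_def)

definition conf ::
  "(side \<Rightarrow> int \<Rightarrow> letter cell) \<Rightarrow> control \<Rightarrow> (side \<Rightarrow> int) \<Rightarrow> int \<Rightarrow> letter config" where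
  "conf T q h k = (to_nat q, [(T Rhs, h Rhs), (T Lhs, h Lhs), (origin_mark, k)])"

abbreviation reach :: "nat \<Rightarrow> letter config \<Rightarrow> letter config \<Rightarrow> bool" where
  "reach \<equiv> reaches subsumption_tm"

lemma reach_cong:
  assumes "reach m (conf T p h k) (conf T q g l)"
    and "m \<le> n" "p = p'" "\<And>s. h s = h' s" "k = k'" "q = q'" "\<And>s. g s = g' s" "l = l'"
  shows "reach n (conf T p' h' k') (conf T q' g' l')"
  using assms reaches_mono by (simp add: conf_def)

lemma reach_transition:
  assumes "q \<notin> {Start, Copy, Accept, Reject}"
    and "case transition q (\<lambda>s. T s (h s)) (origin_mark k) of (r, m, d) \<Rightarrow>
      r = q' \<and> (\<forall>s. shift (m s) (h s) = h' s) \<and> shift d k = k'"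
  shows "reach 1 (conf T q h k) (conf T q' h' k')"
proof (rule reaches_step)
  have "(\<lambda>s. case s of Rhs \<Rightarrow> T Rhs (h Rhs) | Lhs \<Rightarrow> T Lhs (h Lhs)) = (\<lambda>s. T s (h s))"
    by (auto split: side.split)
  then show "step subsumption_tm (conf T q h k) = conf T q' h' k'"
    using assms by (auto simp: conf_def subsumption_tm_def fun_upd_idem split: prod.splits)
qed

lemma reach_Start:
  "reach 1 (initial subsumption_tm w)
    (conf (case_side (input_cells []) (input_cells w)) Copy (\<lambda>_. 0) 0)"
proof (rule reaches_step)
  obtain t where "input_tape w = (t, 0)" by (simp add: input_tape_def)
  moreover have "input_tape [] = ((\<lambda>_. Blank) :: int \<Rightarrow> letter cell, 0)"
    by (auto simp: input_tape_def)
  ultimately show "step subsumption_tm (initial subsumption_tm w)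
      = conf (case_side (input_cells []) (input_cells w)) Copy (\<lambda>_. 0) 0"
    by (simp add: initial_def subsumption_tm_def conf_def origin_mark_def numeral_2_eq_2
        fun_upd_idem)
qed

lemma reach_Copy:
  assumes "word_at t 0 u" "LSub \<notin> set u"
  shows "reach (length u) (conf (case_side (input_cells []) t) Copy (\<lambda>_. 0) 0)
    (conf (case_side (input_cells u) t) Copy (\<lambda>_. int (length u)) 0)"
  using assms
proof (induction u rule: rev_induct)
  case (snoc a u)
  then have "reach (length u) (conf (case_side (input_cells []) t) Copy (\<lambda>_. 0) 0)
    (conf (case_side (input_cells u) t) Copy (\<lambda>_. int (length u)) 0)" by simp
  also have "reach 1 \<dots>
    (conf (case_side (input_cells (u @ [a])) t) Copy (\<lambda>_. int (length (u @ [a]))) 0)"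
    using snoc.prems
    by (intro reaches_step)
      (auto simp: conf_def subsumption_tm_def fun_upd_idem input_cells_snoc[symmetric])
  finally show ?case by simp
qed (simp add: reaches_refl)

lemma reach_Copy_LSub:
  assumes "T Rhs (h Rhs) = Input LSub"
  shows "reach 1 (conf T Copy h k) (conf T Rewind (h(Lhs := h Lhs - 1, Rhs := h Rhs + 1)) k)"
  using assms
  by (intro reaches_step) (simp add: conf_def subsumption_tm_def fun_upd_idem)

lemma reach_Rewind:
  assumes "\<And>i. 0 \<le> i \<Longrightarrow> i < int n \<Longrightarrow> T Lhs i \<noteq> Blank" "T Lhs (- 1) = Blank"
  shows "reach (n + 1) (conf T Rewind (h(Lhs := int n - 1)) 0) (conf T (Visit Rhs) (h(Lhs := 0)) 0)"
  using assms
proof (induction n)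
  case 0
  then have "reach 1 (conf T Rewind (h(Lhs := int 0 - 1)) 0) (conf T (Visit Rhs) (h(Lhs := 0)) 0)"
    by (intro reach_transition) auto
  then show ?case by (rule reaches_mono) simp
next
  case (Suc n)
  have "reach 1 (conf T Rewind (h(Lhs := int (Suc n) - 1)) 0)
      (conf T Rewind (h(Lhs := int n - 1)) 0)"
    using Suc.prems by (intro reach_transition) auto
  also have "reach (n + 1) \<dots> (conf T (Visit Rhs) (h(Lhs := 0)) 0)"
    using Suc.prems by (intro Suc.IH) auto
  finally show ?case by (rule reaches_mono) simp
qed


section \<open>Correctness and running time\<close>

definition decides ::
  "(side \<Rightarrow> int \<Rightarrow> letter cell) \<Rightarrow> side \<Rightarrow> nat \<Rightarrow> (side \<Rightarrow> int) \<Rightarrow> bool \<Rightarrow> bool" where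
  "decides T s n h b \<longleftrightarrow> reach n (conf T (Visit s) h 0) (conf T (Return s b) h 0)"

lemma decides_mono: "decides T s m h b \<Longrightarrow> m \<le> n \<Longrightarrow> decides T s n h b"
  unfolding decides_def by (rule reaches_mono)


subsection \<open>Conjunctions\<close>

lemma reach_Sibling:
  assumes "word_at (T s) i u" "shielded LAnd k u"
  shows "reach (length u) (conf T (Sibling s) (h(s := i)) k)
    (conf T (Sibling s) (h(s := i + int (length u))) (k + nesting u))"
  using assms
proof (induction u arbitrary: i k)
  case (Cons a u)
  have "reach 1 (conf T (Sibling s) (h(s := i)) k)
      (conf T (Sibling s) (h(s := i + 1)) (k + nesting [a]))"
    using Cons.prems by (intro reach_transition) auto
  also have "reach (length u) \<dots>
      (conf T (Sibling s) (h(s := i + 1 + int (length u))) (k + nesting [a] + nesting u))"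
    using Cons.prems by (intro Cons.IH) auto
  finally show ?case by (rule reach_cong) auto
qed (simp add: reaches_refl)

lemma reach_Parent:
  assumes "word_at (T s) (i + 1) u" "shielded LOpen (k + 1) u"
  shows "reach (length u) (conf T (Parent s b) (h(s := i + int (length u))) (k + nesting u))
    (conf T (Parent s b) (h(s := i)) k)"
  using assms
proof (induction u rule: rev_induct)
  case (snoc a u)
  have "reach 1 (conf T (Parent s b) (h(s := i + int (length (u @ [a])))) (k + nesting (u @ [a])))
      (conf T (Parent s b) (h(s := i + int (length u))) (k + nesting u))"
    using snoc.prems by (intro reach_transition) (auto simp: algebra_simps)
  also have "reach (length u) \<dots> (conf T (Parent s b) (h(s := i)) k)"
    using snoc.prems by (intro snoc.IH) auto
  finally show ?case by (rule reach_cong) auto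
qed (simp add: reaches_refl)

lemma reach_Return_left_conjunct:
  assumes "occurs (T s) (h s) (And C D)" "b \<noteq> (s = Lhs)"
  shows "reach (csize C + 3) (conf T (Return s b) (h(s := h s + 1)) 0)
    (conf T (Visit s) (h(s := h s + int (csize C) + 2)) 0)"
proof -
  note node = occurs_AndD[OF assms(1)]
  have "reach 1 (conf T (Return s b) (h(s := h s + 1)) 0) (conf T (ReturnLeft s b) h 0)"
    by (intro reach_transition) auto
  also have "reach 1 \<dots> (conf T (Sibling s) (h(s := h s + 1)) 0)"
    using node(1) assms(2) by (intro reach_transition) auto
  also have "reach (csize C) \<dots> (conf T (Sibling s) (h(s := h s + int (csize C) + 1)) 0)"
    using reach_Sibling[of T s "h s + 1" "word_of C" 0 h] node(2) shielded_LAnd_word_of[of 0 C]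
    by (simp add: occurs_def csize_def add_ac)
  also have "reach 1 \<dots> (conf T (Visit s) (h(s := h s + int (csize C) + 2)) 0)"
    using node(3) by (intro reach_transition) auto
  finally show ?thesis by (rule reaches_mono) simp
qed

lemma reach_Return_right_conjunct:
  assumes "occurs (T s) (h s) (And C D)"
  shows "reach (csize C + 3) (conf T (Return s b) (h(s := h s + int (csize C) + 2)) 0)
    (conf T (Return s b) h 0)"
proof -
  note node = occurs_AndD[OF assms]
  have "reach 1 (conf T (Return s b) (h(s := h s + int (csize C) + 2)) 0)
      (conf T (ReturnLeft s b) (h(s := h s + int (csize C) + 1)) 0)"
    by (intro reach_transition) auto
  also have "reach 1 \<dots> (conf T (Parent s b) (h(s := h s + int (csize C))) 0)"
    using node(3) by (intro reach_transition) auto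
  also have "reach (csize C) \<dots> (conf T (Parent s b) h 0)"
    using reach_Parent[of T s "h s" "word_of C" 0 b h] node(2) shielded_LOpen_word_of[of 1 C]
    by (simp add: occurs_def csize_def)
  also have "reach 1 \<dots> (conf T (Return s b) h 0)"
    using node(1) by (intro reach_transition) auto
  finally show ?thesis by (rule reaches_mono) simp
qed

lemma decides_And:
  assumes node: "occurs (T s) (h s) (And C D)"
    and left: "decides T s m (h(s := h s + 1)) a"
    and right: "decides T s n (h(s := h s + int (csize C) + 2)) b"
  shows "decides T s (m + n + 2 * csize C + 8) h (if s = Lhs then a \<or> b else a \<and> b)"
proof -
  note cells = occurs_AndD[OF node]
  have "T s (h s + 1) \<noteq> Input LGeq" using occurs_hd[OF cells(2)] hd_word_of[of C] by auto
  have "reach 1 (conf T (Visit s) h 0) (conf T (Open s) (h(s := h s + 1)) 0)"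
    using cells(1) by (intro reach_transition) auto
  also have "reach 1 \<dots> (conf T (Visit s) (h(s := h s + 1)) 0)"
    using \<open>T s (h s + 1) \<noteq> Input LGeq\<close> by (intro reach_transition) auto
  also note left[unfolded decides_def]
  finally have left_verdict:
    "reach (1 + 1 + m) (conf T (Visit s) h 0) (conf T (Return s a) (h(s := h s + 1)) 0)" .
  show ?thesis
  proof (cases "a = (s = Lhs)")
    case True
    note left_verdict
    also have "reach 1 (conf T (Return s a) (h(s := h s + 1)) 0) (conf T (ReturnLeft s a) h 0)"
      by (intro reach_transition) auto
    also have "reach 1 \<dots> (conf T (Return s a) h 0)"
      using True cells(1) by (intro reach_transition) auto
    finally have "decides T s (1 + 1 + m + 1 + 1) h a" unfolding decides_def .
    then have "decides T s (m + n + 2 * csize C + 8) h a" by (rule decides_mono) simp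
    then show ?thesis using True by (cases "s = Lhs") simp_all
  next
    case False
    note left_verdict
    also note reach_Return_left_conjunct[of T s h C D a, OF node False]
    also note right[unfolded decides_def]
    also note reach_Return_right_conjunct[of T s h C D b, OF node]
    finally have "decides T s (1 + 1 + m + (csize C + 3) + n + (csize C + 3)) h b"
      unfolding decides_def .
    then have "decides T s (m + n + 2 * csize C + 8) h b" by (rule decides_mono) simp
    then show ?thesis using False by (cases "s = Lhs") simp_all
  qed
qed


subsection \<open>Comparison of basic concepts\<close>

lemma reach_Conjunct:
  assumes "occurs (T s) (h s) C" "\<nexists>D E. C = And D E"
  shows "reach 2 (conf T (Visit s) h 0) (conf T (Conjunct s) h 0)"
proof (cases "\<exists>k R D. C = AtLeast k R D")
  case True
  then have node: "T s (h s) = Input LOpen" "T s (h s + 1) = Input LGeq"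
    using assms(1) occurs_AtLeastD by blast+
  have "reach 1 (conf T (Visit s) h 0) (conf T (Open s) (h(s := h s + 1)) 0)"
    using node by (intro reach_transition) auto
  also have "reach 1 \<dots> (conf T (Conjunct s) h 0)"
    using node by (intro reach_transition) auto
  finally show ?thesis by (rule reaches_mono) simp
next
  case False
  then have "T s (h s) \<noteq> Input LOpen" using assms occurs_hd[OF assms(1)] by (cases C) auto
  then have "reach 1 (conf T (Visit s) h 0) (conf T (Conjunct s) h 0)"
    by (intro reach_transition) auto
  then show ?thesis by (rule reaches_mono) simp
qed

lemma reach_Back_within:
  assumes stop: "\<And>s m. m < l s \<Longrightarrow> T s (h s + int m) \<in> {Input LOpen, Input LConc} \<longleftrightarrow> m = 0"
    and "\<And>s. p s < l s" "\<And>s. p s \<le> n"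
  shows "reach (n + 1) (conf T (Back b) (\<lambda>s. h s + int (p s)) 0) (conf T (Return Lhs b) h 0)"
  using assms(2,3)
proof (induction n arbitrary: p)
  case 0
  then have "p = (\<lambda>_. 0)" by auto
  then have "reach 1 (conf T (Back b) (\<lambda>s. h s + int (p s)) 0) (conf T (Return Lhs b) h 0)"
    using stop[of 0] 0(1) by (intro reach_transition) auto
  then show ?case by (rule reaches_mono) simp
next
  case (Suc n)
  show ?case
  proof (cases "\<forall>s. p s = 0")
    case True
    then have "reach (n + 1) (conf T (Back b) (\<lambda>s. h s + int (p s)) 0) (conf T (Return Lhs b) h 0)"
      using Suc.prems(1) by (intro Suc.IH) auto
    then show ?thesis by (rule reaches_mono) simp
  next
    case False
    have "reach 1 (conf T (Back b) (\<lambda>s. h s + int (p s)) 0)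
        (conf T (Back b) (\<lambda>s. h s + int (p s - 1)) 0)"
      using False stop[OF Suc.prems(1)] by (intro reach_transition) auto
    also have "reach (n + 1) \<dots> (conf T (Return Lhs b) h 0)"
    proof (rule Suc.IH)
      show "p s - 1 < l s" for s using Suc.prems(1)[of s] by simp
      show "p s - 1 \<le> n" for s using Suc.prems(2)[of s] by simp
    qed
    finally show ?thesis by (rule reaches_mono) simp
  qed
qed

lemma reach_Back:
  assumes basic: "\<And>s. basic (e s)" and occurs: "\<And>s. occurs (T s) (h s) (e s)"
    and within: "\<And>s. p s < length (header (e s))"
  shows "reach (csize (e Lhs) + csize (e Rhs)) (conf T (Back b) (\<lambda>s. h s + int (p s)) 0)
    (conf T (Return Lhs b) h 0)"
proof -
  let ?n = "max (p Lhs) (p Rhs)"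
  have "p s \<le> ?n" for s by (cases s) auto
  then have "reach (?n + 1) (conf T (Back b) (\<lambda>s. h s + int (p s)) 0) (conf T (Return Lhs b) h 0)"
    by (intro reach_Back_within[OF occurs_header_cell_iff[OF basic occurs] within])
  moreover have "p s < csize (e s)" for s using within[of s] length_header_le[of "e s"] by simp
  then have "?n + 1 \<le> csize (e Lhs) + csize (e Rhs)"
    by (simp add: Suc_le_eq trans_less_add1 trans_less_add2)
  ultimately show ?thesis by (rule reaches_mono)
qed

lemma reach_CompareNames_common:
  assumes "\<And>s. word_at (T s) (h s) (map Dig u)"
  shows "reach (length u) (conf T CompareNames h 0)
    (conf T CompareNames (\<lambda>s. h s + int (length u)) 0)"
  using assms
proof (induction u arbitrary: h)
  case (Cons a u)
  have "reach 1 (conf T CompareNames h 0) (conf T CompareNames (\<lambda>s. h s + 1) 0)"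
    using Cons.prems by (intro reach_transition) (auto simp: is_digit_def)
  also have "reach (length u) \<dots> (conf T CompareNames (\<lambda>s. h s + 1 + int (length u)) 0)"
    using Cons.prems by (intro Cons.IH) auto
  finally show ?case by (simp add: add_ac)
qed (simp add: reaches_refl)

lemma reach_CompareNames_equal:
  assumes names: "\<And>s. word_at (T s) (h s) (map Dig (A s))" and "A Lhs = A Rhs"
  shows "reach (length (A Lhs)) (conf T CompareNames h 0)
    (conf T CompareNames (\<lambda>s. h s + int (length (A s))) 0)"
proof -
  obtain u where u: "\<And>s. A s = u" by (metis assms(2) side.exhaust)
  have "word_at (T s) (h s) (map Dig u)" for s using names[of s] u by simp
  from reach_CompareNames_common[OF this] show ?thesis using u by simp
qed

lemma reach_CompareNames_distinct:
  assumes names: "\<And>s. word_at (T s) (h s) (map Dig (A s))"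
    and ends: "\<And>s. \<not> is_digit (T s (h s + int (length (A s))))"
    and "A Lhs \<noteq> A Rhs"
  obtains p where "\<forall>s. p \<le> length (A s)"
    and "reach (p + 1) (conf T CompareNames h 0) (conf T (Back False) (\<lambda>s. h s + int p - 1) 0)"
proof -
  obtain w u v where split: "A Lhs = w @ u" "A Rhs = w @ v"
    and differ: "u = [] \<or> v = [] \<or> hd u \<noteq> hd v"
    using longest_common_prefix by blast
  have "\<exists>u. A s = w @ u" for s using split by (cases s) auto
  then have common: "word_at (T s) (h s) (map Dig w)" for s
    using names[of s] by (metis map_append word_at_append)
  let ?x = "\<lambda>s. T s (h s + int (length w))"
  have "is_digit (?x Lhs) \<longleftrightarrow> u \<noteq> []" "is_digit (?x Rhs) \<longleftrightarrow> v \<noteq> []"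
    using names[of Lhs] names[of Rhs] ends[of Lhs] ends[of Rhs] split
    by (cases u; cases v; simp add: is_digit_def)+
  moreover have "?x Lhs \<noteq> ?x Rhs" if "u \<noteq> []" "v \<noteq> []"
    using that names[of Lhs] names[of Rhs] split differ by (cases u; cases v) auto
  ultimately have mismatch: "is_digit (?x Lhs) \<or> is_digit (?x Rhs)" "?x Lhs \<noteq> ?x Rhs"
    using split assms(3) by auto
  note reach_CompareNames_common[of T h w, OF common]
  also have "reach 1 (conf T CompareNames (\<lambda>s. h s + int (length w)) 0)
      (conf T (Back False) (\<lambda>s. h s + int (length w) - 1) 0)"
    using mismatch by (intro reach_transition) auto
  finally show thesis using split by (intro that[of "length w"]) (simp_all add: all_side_iff)
qed

lemma reach_CompareNumbers:
  assumes "word_at (T Lhs) (h Lhs) (map Dig u @ [LRole])"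
    and "word_at (T Rhs) (h Rhs) (map Dig v @ [LRole])"
  shows "reach (length u + length v + 1) (conf T (CompareNumbers c) h 0)
    (conf T (if compare_digits c u v = Some False then Back False else CompareNames)
      (\<lambda>s. h s + int (length (case s of Lhs \<Rightarrow> u | Rhs \<Rightarrow> v)) + 1) 0)"
    (is "reach _ _ (?end c u v h)")
  using assms
proof (induction c u v arbitrary: h rule: compare_digits.induct)
  case (1 c)
  then have "reach 1 (conf T (CompareNumbers c) h 0)
      (conf T (if c = Some False then Back False else CompareNames) (\<lambda>s. h s + 1) 0)"
    by (intro reach_transition) (auto simp: all_side_iff)
  then show ?case by (rule reach_cong) (auto split: side.split)
next
  case (2 c a u)
  let ?g = "h(Lhs := h Lhs + 1)"
  have "reach 1 (conf T (CompareNumbers c) h 0) (conf T (CompareNumbers (Some True)) ?g 0)"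
    using "2.prems" by (intro reach_transition) (auto simp: all_side_iff)
  also have "reach (length u + length ([] :: bool list) + 1) \<dots> (?end (Some True) u [] ?g)"
    using "2.prems" by (intro "2.IH") auto
  finally show ?case by (rule reach_cong) (auto split: side.split)
next
  case (3 c b v)
  let ?g = "h(Rhs := h Rhs + 1)"
  have "reach 1 (conf T (CompareNumbers c) h 0) (conf T (CompareNumbers (Some False)) ?g 0)"
    using "3.prems" by (intro reach_transition) (auto simp: all_side_iff)
  also have "reach (length ([] :: bool list) + length v + 1) \<dots> (?end (Some False) [] v ?g)"
    using "3.prems" by (intro "3.IH") auto
  finally show ?case by (rule reach_cong) (auto split: side.split)
next
  case (4 c a u b v)
  let ?c = "if c = None \<and> a \<noteq> b then Some a else c" and ?g = "\<lambda>s. h s + 1"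
  have "reach 1 (conf T (CompareNumbers c) h 0) (conf T (CompareNumbers ?c) ?g 0)"
    using "4.prems" by (intro reach_transition) (auto simp: all_side_iff)
  also have "reach (length u + length v + 1) \<dots> (?end ?c u v ?g)"
    using "4.prems" by (intro "4.IH") auto
  finally show ?case by (rule reach_cong) (auto split: side.split)
qed

lemma decides_Lhs_distinct_hd:
  assumes "occurs (T Lhs) (h Lhs) c" "\<nexists>c1 c2. c = And c1 c2"
    and "occurs (T Rhs) (h Rhs) d" "hd (word_of c) \<noteq> hd (word_of d)"
  shows "decides T Lhs 3 h False"
proof -
  note reach_Conjunct[of T Lhs h c, OF assms(1,2)]
  also have "reach 1 (conf T (Conjunct Lhs) h 0) (conf T (Return Lhs False) h 0)"
    using occurs_hd[OF assms(1)] occurs_hd[OF assms(3)] assms(4) by (intro reach_transition) auto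
  finally show ?thesis unfolding decides_def by simp
qed

lemma reach_atom_verdict:
  assumes names: "\<And>s. word_at (T s) (h s) (map Dig (A s))"
    and ends: "\<And>s. \<not> is_digit (T s (h s + int (length (A s))))"
      "\<And>s. T s (h s + int (length (A s))) \<noteq> Input LDot"
  obtains p where "\<forall>s. p \<le> length (A s)"
    and "reach (p + 1) (conf T CompareNames h 0)
      (conf T (Back (A Lhs = A Rhs)) (\<lambda>s. h s + int p - 1) 0)"
proof (cases "A Lhs = A Rhs")
  case True
  note reach_CompareNames_equal[of T h A, OF names True]
  also have "reach 1 (conf T CompareNames (\<lambda>s. h s + int (length (A s))) 0)
      (conf T (Back True) (\<lambda>s. h s + int (length (A s)) - 1) 0)"
    using ends[of Lhs] ends[of Rhs] by (intro reach_transition) auto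
  finally have "reach (length (A Lhs) + 1) (conf T CompareNames h 0)
      (conf T (Back (A Lhs = A Rhs)) (\<lambda>s. h s + int (length (A Lhs)) - 1) 0)"
  proof (rule reach_cong)
    show "h s + int (length (A s)) - 1 = h s + int (length (A Lhs)) - 1" for s
      using True by (cases s) simp_all
  qed (use True in auto)
  then show thesis using True by (intro that) (auto simp: all_side_iff)
next
  case False
  from reach_CompareNames_distinct[of T h A, OF names ends(1) False] False that
  show thesis by auto
qed

lemma decides_Lhs_Atom:
  assumes occurs: "\<And>s. occurs (T s) (h s) (Atom (A s))"
  shows "decides T Lhs (2 * csize (Atom (A Lhs)) + csize (Atom (A Rhs)) + 4) h (A Lhs = A Rhs)"
proof -
  have names: "word_at (T s) (h s + 1) (map Dig (A s))"
    and ends: "\<not> is_digit (T s (h s + 1 + int (length (A s))))"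
      "T s (h s + 1 + int (length (A s))) \<noteq> Input LDot" for s
    using occurs[of s] by (auto simp: occurs_def is_digit_def add_ac)
  have "reach 2 (conf T (Visit Lhs) h 0) (conf T (Conjunct Lhs) h 0)"
    using occurs by (rule reach_Conjunct) simp
  also have "reach 1 \<dots> (conf T CompareNames (\<lambda>s. h s + 1) 0)"
    using occurs_hd[OF occurs] by (intro reach_transition) auto
  finally have start: "reach 3 (conf T (Visit Lhs) h 0) (conf T CompareNames (\<lambda>s. h s + 1) 0)"
    by simp
  from reach_atom_verdict[of T "\<lambda>s. h s + 1" A, OF names ends]
  obtain p where "\<forall>s. p \<le> length (A s)" and "reach (p + 1) (conf T CompareNames (\<lambda>s. h s + 1) 0)
    (conf T (Back (A Lhs = A Rhs)) (\<lambda>s. h s + 1 + int p - 1) 0)"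
    by blast
  then have within: "\<forall>s. p < length (header (Atom (A s)))" and compare: "reach (p + 1)
    (conf T CompareNames (\<lambda>s. h s + 1) 0) (conf T (Back (A Lhs = A Rhs)) (\<lambda>s. h s + int p) 0)"
    by (simp_all add: less_Suc_eq_le)
  note start
  also note compare
  also have "reach (csize (Atom (A Lhs)) + csize (Atom (A Rhs)))
      (conf T (Back (A Lhs = A Rhs)) (\<lambda>s. h s + int p) 0) (conf T (Return Lhs (A Lhs = A Rhs)) h 0)"
    using reach_Back[of "\<lambda>s. Atom (A s)" T h "\<lambda>_. p"] occurs within by simp
  finally show ?thesis
    unfolding decides_def using spec[OF within, of Lhs] by (elim reaches_mono) simp_all
qed

context
  fixes T :: "side \<Rightarrow> int \<Rightarrow> letter cell" and h :: "side \<Rightarrow> int"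
    and k :: "side \<Rightarrow> num" and R :: "side \<Rightarrow> name" and D :: "side \<Rightarrow> concept"
  assumes occurs: "\<And>s. occurs (T s) (h s) (AtLeast (k s) (R s) (D s))"
begin

abbreviation role_start :: "side \<Rightarrow> int" where
  "role_start s \<equiv> h s + 3 + int (length (digits (k s)))"

abbreviation role_end :: "side \<Rightarrow> int" where
  "role_end s \<equiv> role_start s + int (length (R s))"

lemma role_cells:
  "word_at (T s) (role_start s) (map Dig (R s))" "T s (role_end s) = Input LDot"
  using occurs_AtLeastD(4)[OF occurs[of s]] by simp_all

lemma reach_role_names:
  "reach (length (digits (k Lhs)) + length (digits (k Rhs)) + 5) (conf T (Visit Lhs) h 0)
    (conf T (if k Rhs \<le> k Lhs then CompareNames else Back False) role_start 0)"
proof -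
  note node = occurs_AtLeastD[OF occurs]
  have "reach 2 (conf T (Visit Lhs) h 0) (conf T (Conjunct Lhs) h 0)"
    using occurs by (rule reach_Conjunct) simp
  also have "reach 1 \<dots> (conf T (CompareNumbers None) (\<lambda>s. h s + 1) 0)"
    using node(1) by (intro reach_transition) auto
  also have "reach 1 \<dots> (conf T (CompareNumbers None) (\<lambda>s. h s + 2) 0)"
    using node(2) by (intro reach_transition) (auto simp: all_side_iff)
  also note reach_CompareNumbers[of T "\<lambda>s. h s + 2", OF node(3) node(3)]
  finally show ?thesis
    by (rule reach_cong) (auto simp: compare_digits_iff[symmetric] split: side.split)
qed

lemma reach_role_mismatch:
  assumes "R Lhs \<noteq> R Rhs"
  obtains p where "\<forall>s. p s < length (header (AtLeast (k s) (R s) (D s)))"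
    and "reach (length (R Lhs) + 1) (conf T CompareNames role_start 0)
      (conf T (Back False) (\<lambda>s. h s + int (p s)) 0)"
proof -
  have "\<not> is_digit (T s (role_end s))" for s using role_cells(2) by (simp add: is_digit_def)
  from reach_CompareNames_distinct[of T role_start R, OF role_cells(1) this assms]
  obtain m where m: "\<forall>s. m \<le> length (R s)" and mismatch: "reach (m + 1)
    (conf T CompareNames role_start 0) (conf T (Back False) (\<lambda>s. role_start s + int m - 1) 0)"
    by blast
  show thesis
  proof (rule that)
    show "\<forall>s. 2 + length (digits (k s)) + m < length (header (AtLeast (k s) (R s) (D s)))"
      using m by (simp add: less_Suc_eq_le le_SucI)
    show "reach (length (R Lhs) + 1) (conf T CompareNames role_start 0)
      (conf T (Back False) (\<lambda>s. h s + int (2 + length (digits (k s)) + m)) 0)"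
      using mismatch by (rule reach_cong) (use m in auto)
  qed
qed

lemma reach_body_verdict:
  assumes "R Lhs = R Rhs" and body: "decides T Rhs n (\<lambda>s. role_end s + 1) b"
  shows "reach (length (R Lhs) + n + 3) (conf T CompareNames role_start 0)
    (conf T (Back b) role_end 0)"
proof -
  note reach_CompareNames_equal[of T role_start R, OF role_cells(1) assms(1)]
  also have "reach 1 (conf T CompareNames role_end 0) (conf T (Visit Rhs) (\<lambda>s. role_end s + 1) 0)"
    using role_cells(2) by (intro reach_transition) (auto simp: is_digit_def)
  also note body[unfolded decides_def]
  also have "reach 1 (conf T (Return Rhs b) (\<lambda>s. role_end s + 1) 0)
      (conf T (ReturnLeft Rhs b) ((\<lambda>s. role_end s + 1)(Rhs := role_end Rhs)) 0)"
    by (intro reach_transition) auto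
  also have "reach 1 \<dots> (conf T (Back b) role_end 0)"
    using role_cells(2) by (intro reach_transition) (auto simp: all_side_iff)
  finally show ?thesis by (rule reaches_mono) simp
qed

lemma reach_restriction_verdict:
  assumes body: "k Rhs \<le> k Lhs \<Longrightarrow> R Lhs = R Rhs \<Longrightarrow> decides T Rhs n (\<lambda>s. role_end s + 1) b"
  obtains p where "\<forall>s. p s < length (header (AtLeast (k s) (R s) (D s)))"
    and "reach (length (digits (k Lhs)) + length (digits (k Rhs)) + 5 + (length (R Lhs) + n + 3))
      (conf T (Visit Lhs) h 0)
      (conf T (Back (k Rhs \<le> k Lhs \<and> R Lhs = R Rhs \<and> b)) (\<lambda>s. h s + int (p s)) 0)"
proof -
  let ?b = "k Rhs \<le> k Lhs \<and> R Lhs = R Rhs \<and> b"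
  consider (numbers) "\<not> k Rhs \<le> k Lhs" | (roles) "k Rhs \<le> k Lhs" "R Lhs \<noteq> R Rhs"
    | (match) "k Rhs \<le> k Lhs" "R Lhs = R Rhs" by blast
  then obtain p where within: "\<forall>s. p s < length (header (AtLeast (k s) (R s) (D s)))"
    and verdict: "reach (length (R Lhs) + n + 3)
      (conf T (if k Rhs \<le> k Lhs then CompareNames else Back False) role_start 0)
      (conf T (Back ?b) (\<lambda>s. h s + int (p s)) 0)"
  proof cases
    case numbers
    have "reach (length (R Lhs) + n + 3) (conf T (Back ?b) role_start 0)
        (conf T (Back ?b) (\<lambda>s. h s + int (3 + length (digits (k s)))) 0)"
      using reaches_refl by (rule reach_cong) auto
    then show thesis using numbers by (intro that[of "\<lambda>s. 3 + length (digits (k s))"]) auto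
  next
    case roles
    from roles(2) obtain p where "\<forall>s. p s < length (header (AtLeast (k s) (R s) (D s)))"
      and "reach (length (R Lhs) + 1) (conf T CompareNames role_start 0)
        (conf T (Back False) (\<lambda>s. h s + int (p s)) 0)"
      by (rule reach_role_mismatch)
    then show thesis using roles by (intro that) (auto elim: reaches_mono)
  next
    case match
    from reach_body_verdict[OF match(2) body[OF match]]
    have "reach (length (R Lhs) + n + 3) (conf T CompareNames role_start 0)
        (conf T (Back b) (\<lambda>s. h s + int (3 + length (digits (k s)) + length (R s))) 0)"
      by (rule reach_cong) auto
    then show thesis
      using match by (intro that[of "\<lambda>s. 3 + length (digits (k s)) + length (R s)"]) auto
  qed
  from reaches_trans[OF reach_role_names verdict] within show thesis by (rule that[rotated])
qed

lemma decides_Lhs_AtLeast: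
  assumes "k Rhs \<le> k Lhs \<Longrightarrow> R Lhs = R Rhs \<Longrightarrow> decides T Rhs n (\<lambda>s. role_end s + 1) b"
  shows "decides T Lhs
    (n + 2 * csize (AtLeast (k Lhs) (R Lhs) (D Lhs)) + 2 * csize (AtLeast (k Rhs) (R Rhs) (D Rhs)))
    h (k Rhs \<le> k Lhs \<and> R Lhs = R Rhs \<and> b)"
proof -
  let ?e = "\<lambda>s. AtLeast (k s) (R s) (D s)" and ?b = "k Rhs \<le> k Lhs \<and> R Lhs = R Rhs \<and> b"
  let ?n = "length (digits (k Lhs)) + length (digits (k Rhs)) + 5 + (length (R Lhs) + n + 3)"
  obtain p where within: "\<forall>s. p s < length (header (?e s))" and verdict:
    "reach ?n (conf T (Visit Lhs) h 0) (conf T (Back ?b) (\<lambda>s. h s + int (p s)) 0)"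
    using assms by (rule reach_restriction_verdict)
  note verdict
  also have "reach (csize (?e Lhs) + csize (?e Rhs)) (conf T (Back ?b) (\<lambda>s. h s + int (p s)) 0)
      (conf T (Return Lhs ?b) h 0)"
    using within occurs by (intro reach_Back[of ?e]) auto
  finally show ?thesis unfolding decides_def by (rule reaches_mono) simp
qed

end


subsection \<open>Evaluation of all pairs of subconcepts\<close>

definition is_root :: "(int \<Rightarrow> letter cell) \<Rightarrow> int \<Rightarrow> bool" where
  "is_root t i \<longleftrightarrow> t (i - 1) \<notin> {Input LOpen, Input LAnd}"

lemma decides_Rhs_Top:
  assumes "occurs (T Rhs) (h Rhs) Top"
  shows "decides T Rhs 3 h True"
proof -
  have "reach 2 (conf T (Visit Rhs) h 0) (conf T (Conjunct Rhs) h 0)"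
    using assms by (rule reach_Conjunct) simp
  also have "reach 1 \<dots> (conf T (Return Rhs True) h 0)"
    using occurs_hd[OF assms] by (intro reach_transition) auto
  finally show ?thesis unfolding decides_def by simp
qed

lemma decides_Rhs_basic:
  assumes basic: "basic d" and Rhs: "occurs (T Rhs) (h Rhs) d" and root: "is_root (T Lhs) (h Lhs)"
    and Lhs: "decides T Lhs n h b"
  shows "decides T Rhs (n + 5) h b"
proof -
  have "reach 2 (conf T (Visit Rhs) h 0) (conf T (Conjunct Rhs) h 0)"
    using basic Rhs by (intro reach_Conjunct[of T Rhs h d]) auto
  also have "reach 1 \<dots> (conf T (Visit Lhs) h 0)"
    using occurs_hd[OF Rhs] basic by (intro reach_transition) (cases d; simp)+
  also note Lhs[unfolded decides_def]
  also have "reach 1 (conf T (Return Lhs b) h 0)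
      (conf T (ReturnLeft Lhs b) (h(Lhs := h Lhs - 1)) 0)"
    by (intro reach_transition) auto
  also have "reach 1 \<dots> (conf T (Return Rhs b) h 0)"
    using root by (intro reach_transition) (auto simp: is_root_def)
  finally show ?thesis unfolding decides_def by (rule reaches_mono) simp
qed

text \<open>\<open>K\<close> bounds the number of steps spent at a single pair of nodes.\<close>

definition evaluates :: "(side \<Rightarrow> int \<Rightarrow> letter cell) \<Rightarrow> nat \<Rightarrow> concept \<Rightarrow> bool" where
  "evaluates T K D \<longleftrightarrow> (\<forall>C h. occurs (T Rhs) (h Rhs) D \<longrightarrow> occurs (T Lhs) (h Lhs) C \<longrightarrow>
     is_root (T Lhs) (h Lhs) \<longrightarrow> 2 * (csize D + csize C) + 20 \<le> K \<longrightarrow>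
     decides T Rhs (K * Suc (csize D) * csize C) h (covers D C))"

lemma evaluatesI:
  assumes "\<And>C h. occurs (T Rhs) (h Rhs) D \<Longrightarrow> occurs (T Lhs) (h Lhs) C \<Longrightarrow>
    is_root (T Lhs) (h Lhs) \<Longrightarrow> 2 * (csize D + csize C) + 20 \<le> K \<Longrightarrow>
    decides T Rhs (K * Suc (csize D) * csize C) h (covers D C)"
  shows "evaluates T K D"
  using assms unfolding evaluates_def by blast

lemma evaluatesD:
  assumes "evaluates T K D" "occurs (T Rhs) (h Rhs) D" "occurs (T Lhs) (h Lhs) C"
    and "is_root (T Lhs) (h Lhs)" "2 * (csize D + csize C) + 20 \<le> K"
  shows "decides T Rhs (K * Suc (csize D) * csize C) h (covers D C)"
  using assms unfolding evaluates_def by blast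

lemma decides_Lhs_restrictions:
  assumes Rhs: "occurs (T Rhs) (h Rhs) (AtLeast k R D)"
    and Lhs: "occurs (T Lhs) (h Lhs) (AtLeast l S E)"
    and body: "evaluates T K D"
    and budget: "2 * (csize (AtLeast k R D) + csize (AtLeast l S E)) + 20 \<le> K"
  shows "decides T Lhs (K * csize (AtLeast k R D) * csize (AtLeast l S E)) h
    (covers (AtLeast k R D) (AtLeast l S E))"
proof -
  let ?k = "case_side l k" and ?R = "case_side S R" and ?D = "case_side E D"
  let ?d = "csize (AtLeast k R D)" and ?c = "csize (AtLeast l S E)"
    and ?n = "K * Suc (csize D) * csize E"
  let ?body = "\<lambda>s. h s + 3 + int (length (digits (?k s))) + int (length (?R s)) + 1"
  have "is_root (T Lhs) (?body Lhs)"
    using occurs_AtLeastD(4)[OF Lhs] by (simp add: is_root_def add_ac)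
  moreover have "occurs (T Rhs) (?body Rhs) D" "occurs (T Lhs) (?body Lhs) E"
    using occurs_AtLeastD(5)[OF Rhs] occurs_AtLeastD(5)[OF Lhs] by (simp_all add: add_ac)
  ultimately have "decides T Rhs ?n ?body (covers D E)"
    using budget by (intro evaluatesD[OF body]) auto
  moreover have "occurs (T s) (h s) (AtLeast (?k s) (?R s) (?D s))" for s
    using Rhs Lhs by (cases s) simp_all
  ultimately have "decides T Lhs (?n + 2 * ?c + 2 * ?d) h (k \<le> l \<and> S = R \<and> covers D E)"
    using decides_Lhs_AtLeast[of T h ?k ?R ?D ?n "covers D E"] by simp
  also have "(k \<le> l \<and> S = R \<and> covers D E) \<longleftrightarrow> covers (AtLeast k R D) (AtLeast l S E)" by auto
  finally show ?thesis
  proof (rule decides_mono)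
    have "?n \<le> K * ?d * csize E" by (intro mult_le_mono) simp_all
    moreover have "2 * ?c + 2 * ?d \<le> K * ?d" using budget by (intro le_mult_csize) simp
    ultimately have "?n + 2 * ?c + 2 * ?d \<le> K * ?d * (csize E + 1)"
      by (simp only: distrib_left mult_1_right)
    also have "\<dots> \<le> K * ?d * ?c" by (intro mult_le_mono) simp_all
    finally show "?n + 2 * ?c + 2 * ?d \<le> K * ?d * ?c" .
  qed
qed

lemma decides_Lhs_conjunct:
  assumes basic: "basic d" and Rhs: "occurs (T Rhs) (h Rhs) d"
    and no_And: "\<nexists>c1 c2. c = And c1 c2" and Lhs: "occurs (T Lhs) (h Lhs) c"
    and budget: "2 * (csize d + csize c) + 20 \<le> K"
    and body: "\<And>k R D. d = AtLeast k R D \<Longrightarrow> evaluates T K D"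
  shows "decides T Lhs (K * csize d * csize c) h (covers d c)"
proof -
  have bound: "2 * (csize d + csize c) + 20 \<le> K * csize d * csize c"
    using budget by (intro le_mult_csize)
  consider (atoms) A B where "d = Atom A" "c = Atom B"
    | (restrictions) k R D l S E where "d = AtLeast k R D" "c = AtLeast l S E"
    | (distinct) "hd (word_of c) \<noteq> hd (word_of d)" "\<not> covers d c"
    using basic no_And by (cases d; cases c) auto
  then show ?thesis
  proof cases
    case atoms
    then have "occurs (T s) (h s) (Atom (case_side B A s))" for s
      using Lhs Rhs by (cases s) simp_all
    then have "decides T Lhs (2 * csize c + csize d + 4) h (B = A)"
      using decides_Lhs_Atom[of T h "case_side B A"] atoms by simp
    also have "(B = A) \<longleftrightarrow> covers d c" using atoms by auto
    finally show ?thesis by (rule decides_mono) (rule le_trans[OF _ bound], simp)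
  next
    case restrictions
    show ?thesis
      unfolding restrictions using Rhs Lhs budget body restrictions
      by (intro decides_Lhs_restrictions) simp_all
  next
    case distinct
    then have "decides T Lhs 3 h (covers d c)"
      using decides_Lhs_distinct_hd[of T h c d] Lhs Rhs no_And by simp
    then show ?thesis by (rule decides_mono) (rule le_trans[OF _ bound], simp)
  qed
qed

lemma decides_Lhs_basic:
  assumes basic: "basic d" and Rhs: "occurs (T Rhs) i d"
    and body: "\<And>k R D. d = AtLeast k R D \<Longrightarrow> evaluates T K D"
  shows "occurs (T Lhs) (h Lhs) C \<Longrightarrow> h Rhs = i \<Longrightarrow> 2 * (csize d + csize C) + 20 \<le> K \<Longrightarrow>
    decides T Lhs (K * csize d * csize C) h (covers d C)"
proof (induction C arbitrary: h)
  case (And C1 C2)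
  note node = occurs_AndD[OF And.prems(1)]
  let ?t = "\<lambda>C. K * csize d * csize C"
  have "decides T Lhs (?t C1) (h(Lhs := h Lhs + 1)) (covers d C1)"
    using node And.prems by (intro And.IH) auto
  moreover have "decides T Lhs (?t C2) (h(Lhs := h Lhs + int (csize C1) + 2)) (covers d C2)"
    using node And.prems by (intro And.IH) auto
  ultimately have "decides T Lhs (?t C1 + ?t C2 + 2 * csize C1 + 8) h (covers d (And C1 C2))"
    using decides_And[of T Lhs h C1 C2, OF And.prems(1)] basic by (auto simp: covers_And_iff)
  moreover have "2 * csize C1 + 8 \<le> K * csize d"
    using And.prems(3) by (intro le_mult_csize) simp
  ultimately show ?case by (elim decides_mono) (simp add: distrib_left)
next
  case (Atom B)
  then show ?case using basic Rhs body by (intro decides_Lhs_conjunct) auto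
next
  case Top
  then show ?case using basic Rhs body by (intro decides_Lhs_conjunct) auto
next
  case (AtLeast l S E)
  then show ?case using basic Rhs body by (intro decides_Lhs_conjunct) auto
qed

lemma evaluates_basic:
  assumes basic: "basic d" and body: "\<And>k R D. d = AtLeast k R D \<Longrightarrow> evaluates T K D"
  shows "evaluates T K d"
proof (rule evaluatesI)
  fix C h
  assume Rhs: "occurs (T Rhs) (h Rhs) d" and Lhs: "occurs (T Lhs) (h Lhs) C"
    and root: "is_root (T Lhs) (h Lhs)" and budget: "2 * (csize d + csize C) + 20 \<le> K"
  have "decides T Lhs (K * csize d * csize C) h (covers d C)"
    using basic Rhs body Lhs refl budget by (rule decides_Lhs_basic)
  then have "decides T Rhs (K * csize d * csize C + 5) h (covers d C)"
    by (rule decides_Rhs_basic[OF basic Rhs root])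
  moreover have "5 \<le> K * csize C" using budget by (intro le_mult_csize) simp
  ultimately show "decides T Rhs (K * Suc (csize d) * csize C) h (covers d C)"
    by (elim decides_mono) (simp add: distrib_left distrib_right)
qed

lemma evaluates_Top: "evaluates T K Top"
proof (rule evaluatesI)
  fix C h
  assume "occurs (T Rhs) (h Rhs) Top" and budget: "2 * (csize Top + csize C) + 20 \<le> K"
  then have "decides T Rhs 3 h True" by (intro decides_Rhs_Top)
  moreover have "3 \<le> K * csize C" using budget by (intro le_mult_csize) simp
  ultimately show "decides T Rhs (K * Suc (csize Top) * csize C) h (covers Top C)"
    by (auto elim!: decides_mono simp: distrib_right)
qed

lemma evaluates_And:
  assumes "evaluates T K D" "evaluates T K E"
  shows "evaluates T K (And D E)"
proof (rule evaluatesI)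
  fix C h
  assume Rhs: "occurs (T Rhs) (h Rhs) (And D E)" and Lhs: "occurs (T Lhs) (h Lhs) C"
    and root: "is_root (T Lhs) (h Lhs)" and budget: "2 * (csize (And D E) + csize C) + 20 \<le> K"
  let ?t = "\<lambda>D. K * Suc (csize D) * csize C"
  have "decides T Rhs (?t D) (h(Rhs := h Rhs + 1)) (covers D C)"
    using occurs_AndD[OF Rhs] Lhs root budget by (intro evaluatesD[OF assms(1)]) auto
  moreover have "decides T Rhs (?t E) (h(Rhs := h Rhs + int (csize D) + 2)) (covers E C)"
    using occurs_AndD[OF Rhs] Lhs root budget by (intro evaluatesD[OF assms(2)]) auto
  ultimately have "decides T Rhs (?t D + ?t E + 2 * csize D + 8) h (covers (And D E) C)"
    using decides_And[of T Rhs h D E, OF Rhs] by auto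
  moreover have "2 * csize D + 8 \<le> K * csize C" using budget by (intro le_mult_csize) simp
  ultimately show "decides T Rhs (?t (And D E)) h (covers (And D E) C)"
    by (elim decides_mono) (simp add: distrib_left distrib_right)
qed

lemma evaluates_concept: "evaluates T K D"
proof (induction D)
  case (Atom A)
  show ?case by (rule evaluates_basic) simp_all
next
  case Top
  show ?case by (rule evaluates_Top)
next
  case (And D E)
  then show ?case by (rule evaluates_And)
next
  case (AtLeast k R D)
  show ?case by (rule evaluates_basic) (use AtLeast in auto)
qed


subsection \<open>Complete runs\<close>

definition concept_cells :: "concept \<Rightarrow> concept \<Rightarrow> side \<Rightarrow> int \<Rightarrow> letter cell" where
  "concept_cells C D = case_side (input_cells (word_of C)) (input_cells (input_word C D))"

lemma concept_cells_Lhs: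
  "occurs (concept_cells C D Lhs) 0 C" "concept_cells C D Lhs (- 1) = Blank"
  using word_at_input_cells[of "word_of C"] input_cells_outside[of _ "word_of C"]
  by (simp_all add: occurs_def concept_cells_def csize_def)

lemma concept_cells_Rhs:
  "word_at (concept_cells C D Rhs) 0 (word_of C)"
  "concept_cells C D Rhs (int (csize C)) = Input LSub"
  "occurs (concept_cells C D Rhs) (int (csize C) + 1) D"
  using word_at_input_cells[of "input_word C D"] input_cells_outside[of _ "input_word C D"]
  by (simp_all add: occurs_def concept_cells_def input_word_def csize_def)

lemma reach_Visit_root:
  "reach (2 * csize C + 3) (initial subsumption_tm (input_word C D))
    (conf (concept_cells C D) (Visit Rhs) (case_side 0 (int (csize C) + 1)) 0)"
proof -
  let ?T = "concept_cells C D" and ?n = "int (csize C)"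
  let ?h = "(\<lambda>_. ?n)(Rhs := ?n + 1)"
  have "reach 1 (initial subsumption_tm (input_word C D))
      (conf (case_side (input_cells []) (?T Rhs)) Copy (\<lambda>_. 0) 0)"
    using reach_Start by (simp add: concept_cells_def)
  also have "reach (csize C) \<dots> (conf ?T Copy (\<lambda>_. ?n) 0)"
    using reach_Copy[OF concept_cells_Rhs(1) LSub_notin_word_of]
    by (simp add: concept_cells_def csize_def)
  also have "reach 1 \<dots> (conf ?T Rewind (?h(Lhs := ?n - 1)) 0)"
    using reach_Copy_LSub[of ?T "\<lambda>_. ?n", OF concept_cells_Rhs(2)] by (rule reach_cong) auto
  also have "reach (csize C + 1) \<dots> (conf ?T (Visit Rhs) (case_side 0 (?n + 1)) 0)"
  proof -
    have "?T Lhs i \<noteq> Blank" if "0 \<le> i" "i < ?n" for i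
      using that by (simp add: concept_cells_def csize_def input_tape_def)
    from reach_Rewind[of "csize C" ?T ?h, OF this concept_cells_Lhs(2)] show ?thesis
      by (rule reach_cong) (auto split: side.split)
  qed
  finally show ?thesis by (rule reaches_mono) simp
qed

theorem subsumption_tm_decides:
  fixes C D
  defines "K \<equiv> 2 * (csize C + csize D) + 20"
  shows "\<exists>c. reach (2 * csize C + 5 + K * Suc (csize D) * csize C)
      (initial subsumption_tm (input_word C D)) c \<and>
    fst c = (if subsumed C D then accept subsumption_tm else reject subsumption_tm)"
proof -
  let ?T = "concept_cells C D" and ?b = "covers D C" and ?n = "int (csize C)"
  let ?end = "conf ?T (if ?b then Accept else Reject) (case_side 0 ?n) 0"
  have "decides ?T Rhs (K * Suc (csize D) * csize C) (case_side 0 (?n + 1)) ?b"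
    using concept_cells_Lhs[of C D] concept_cells_Rhs(3)[of C D]
    by (intro evaluatesD[OF evaluates_concept]) (simp_all add: is_root_def K_def)
  note verdict = this[unfolded decides_def]
  note reach_Visit_root[of C D]
  also note verdict
  also have "reach 1 (conf ?T (Return Rhs ?b) (case_side 0 (?n + 1)) 0)
      (conf ?T (ReturnLeft Rhs ?b) (case_side 0 ?n) 0)"
    by (intro reach_transition) (auto split: side.split)
  also have "reach 1 \<dots> ?end"
    using concept_cells_Rhs(2) by (intro reach_transition) auto
  finally have "reach (2 * csize C + 5 + K * Suc (csize D) * csize C)
      (initial subsumption_tm (input_word C D)) ?end"
    by (rule reaches_mono) simp
  moreover have "fst ?end = (if subsumed C D then accept subsumption_tm else reject subsumption_tm)"
    by (simp add: conf_def subsumption_tm_def subsumed_iff_covers)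
  ultimately show ?thesis by blast
qed

theorem theorem8:
  "\<exists>(M :: letter tm) (p :: nat poly). turing_machine M \<and>
     (\<forall>C C'.
        (subsumed C C' \<longrightarrow> accepts_within M (input_word C C') (poly p (csize C + csize C'))) \<and>
        (\<not> subsumed C C' \<longrightarrow> rejects_within M (input_word C C') (poly p (csize C + csize C'))))"
proof (intro exI conjI allI)
  show "turing_machine subsumption_tm" by (rule turing_machine_subsumption_tm)
next
  fix C C'
  let ?n = "csize C + csize C'" and ?p = "[:5, 22, 22, 2:] :: nat poly"
  have "2 * csize C + 5 + (2 * ?n + 20) * Suc (csize C') * csize C
      \<le> 2 * ?n + 5 + (2 * ?n + 20) * Suc ?n * ?n"
    by (intro add_mono mult_le_mono) simp_all
  also have "\<dots> = poly ?p ?n" by (simp add: algebra_simps)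
  finally obtain c where "reach (poly ?p ?n) (initial subsumption_tm (input_word C C')) c"
    and "fst c = (if subsumed C C' then accept subsumption_tm else reject subsumption_tm)"
    using subsumption_tm_decides[of C C'] reaches_mono by blast
  then show "subsumed C C' \<longrightarrow> accepts_within subsumption_tm (input_word C C') (poly ?p ?n)"
    and "\<not> subsumed C C' \<longrightarrow> rejects_within subsumption_tm (input_word C C') (poly ?p ?n)"
    by (metis accepts_within_if_reaches, metis rejects_within_if_reaches)
qed

end
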